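(* Let $n_1,n_2\geq1$. For the null X-ray transform on the Minkowski space $\mathbb{R}^{n_1,n_2}$ the following hold: (1) If $n_1=n_2=1$, the null X-ray transform is injective on neither $\mathcal{S}(\mathbb{R}^{n_1,n_2})$ nor $C_0^\infty(\mathbb{R}^{n_1,n_2})$. (2) If $n_1=1$ and $n_2>1$, the null X-ray transform is injective on $C_0^\infty(\mathbb{R}^{n_1,n_2})$. (3) If $n_1=1$ and $n_2>1$, the kernel of the null X-ray transform on $\mathcal{S}(\mathbb{R}^{n_1,n_2})$ consists precisely of the functions whose Fourier transform is supported in the timelike light cone $\{v\in\mathbb{R}^{n_1,n_2} : v_1^2-v_2^2-\cdots-v_{n_1+n_2}^2\geq0\}$. (4) If $n_1>1$ and $n_2>1$, the null X-ray transform is injective on both $\mathcal{S}(\mathbb{R}^{n_1,n_2})$ and $C_0^\infty(\mathbb{R}^{n_1,n_2})$.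
   Context: The Minkowski space $\mathbb{R}^{n_1,n_2}$ is $\mathbb{R}^{n_1+n_2}$ with the pseudo-Riemannian metric $\mathrm{d}x_1^2+\cdots+\mathrm{d}x_{n_1}^2-\mathrm{d}x_{n_1+1}^2-\cdots-\mathrm{d}x_{n_1+n_2}^2$. A vector $v$ is null if $v_1^2+\cdots+v_{n_1}^2-v_{n_1+1}^2-\cdots-v_{n_1+n_2}^2=0$. Let $D$ be the set of null vectors of Euclidean norm one. The null X-ray transform is $f\mapsto(R_vf)_{v\in D}$, where $R_vf(x)=\int_{\mathbb{R}}f(x+tv)\,\mathrm{d}t$ for $x\in\mathbb{R}^{n_1+n_2}$; its kernel is the set of $f$ with $R_vf\equiv0$ for all $v\in D$. $\mathcal{S}(\mathbb{R}^{n_1,n_2})$ and $C_0^\infty(\mathbb{R}^{n_1,n_2})$ are the spaces of complex-valued Schwartz functions and of compactly supported smooth complex-valued functions on $\mathbb{R}^{n_1+n_2}$. The Fourier transform is the Euclidean one, $\mathcal{F}f(k)=\int e^{-ik\cdot y}f(y)\,\mathrm{d}y$ with $k\cdot y$ the Euclidean inner product. *)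

theory Defs
  imports "HOL-Analysis.Analysis"
begin

text \<open>
  The space \<open>\<real>\<^sup>n\<close> with \<open>n = n\<^sub>1 + n\<^sub>2\<close> is modelled by vectors indexed by the sum type
  \<open>'m + 'n\<close> with \<open>CARD('m) = n\<^sub>1\<close> and \<open>CARD('n) = n\<^sub>2\<close>: the coordinates \<open>Inl i\<close> are the
  \<open>n\<^sub>1\<close> positive directions of the metric and the coordinates \<open>Inr j\<close> the \<open>n\<^sub>2\<close> negative
  ones. Since \<open>'m\<close> and \<open>'n\<close> are nonempty, \<open>n\<^sub>1, n\<^sub>2 \<ge> 1\<close> holds automatically. The norm,
  the inner product and Lebesgue measure on this type are the Euclidean ones.
\<close>

type_synonym ('m, 'n) minkowski = "real ^ ('m + 'n)"

definition minkowski_form :: "('m::finite, 'n::finite) minkowski \<Rightarrow> real" where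
  "minkowski_form v = (\<Sum>i\<in>UNIV. (v $ Inl i)\<^sup>2) - (\<Sum>j\<in>UNIV. (v $ Inr j)\<^sup>2)"

definition null_directions :: "('m::finite, 'n::finite) minkowski set" where
  "null_directions = {v. minkowski_form v = 0 \<and> norm v = 1}"

definition timelike_cone :: "('m::finite, 'n::finite) minkowski set" where
  "timelike_cone = {v. minkowski_form v \<ge> 0}"

definition partial_deriv :: "'k::finite \<Rightarrow> (real ^ 'k \<Rightarrow> complex) \<Rightarrow> real ^ 'k \<Rightarrow> complex" where
  "partial_deriv i f x = vector_derivative (\<lambda>t. f (x + t *\<^sub>R axis i 1)) (at 0)"

primrec iterated_partial :: "'k::finite list \<Rightarrow> (real ^ 'k \<Rightarrow> complex) \<Rightarrow> real ^ 'k \<Rightarrow> complex" where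
  "iterated_partial [] f = f"
| "iterated_partial (i # is) f = partial_deriv i (iterated_partial is f)"

text \<open>
  Requiring (total) differentiability of the iterated partial derivatives of every order,
  the function itself included, makes all of them exist and be continuous, so this is the
  usual class of infinitely differentiable functions (real-differentiable, complex-valued).
\<close>

definition smooth :: "(real ^ 'k::finite \<Rightarrow> complex) \<Rightarrow> bool" where
  "smooth f \<longleftrightarrow> (\<forall>is. iterated_partial is f differentiable_on UNIV)"

definition schwartz_functions :: "(real ^ 'k::finite \<Rightarrow> complex) set" where
  "schwartz_functions =
     {f. smooth f \<and> (\<forall>m is. bounded (range (\<lambda>x. norm x ^ m *\<^sub>R iterated_partial is f x)))}"

definition function_support :: "(real ^ 'k::finite \<Rightarrow> complex) \<Rightarrow> (real ^ 'k) set" where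
  "function_support f = closure {x. f x \<noteq> 0}"

definition test_functions :: "(real ^ 'k::finite \<Rightarrow> complex) set" where
  "test_functions = {f. smooth f \<and> compact (function_support f)}"

definition fourier_transform :: "(real ^ 'k::finite \<Rightarrow> complex) \<Rightarrow> real ^ 'k \<Rightarrow> complex" where
  "fourier_transform f k = (LINT y|lborel. exp (- (\<i> * complex_of_real (k \<bullet> y))) * f y)"

definition line_integral :: "real ^ 'k::finite \<Rightarrow> (real ^ 'k \<Rightarrow> complex) \<Rightarrow> real ^ 'k \<Rightarrow> complex" where
  "line_integral v f x = (LINT t|lborel. f (x + t *\<^sub>R v))"

text \<open>
  The transform is the family of line integrals indexed by the null directions only, hence
  the restriction: equality of transforms does not compare line integrals in other directions.
\<close>

definition null_xray ::
    "(('m::finite, 'n::finite) minkowski \<Rightarrow> complex) \<Rightarrow>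
     ('m, 'n) minkowski \<Rightarrow> ('m, 'n) minkowski \<Rightarrow> complex" where
  "null_xray f = restrict (\<lambda>v. line_integral v f) null_directions"

definition null_xray_kernel :: "(('m::finite, 'n::finite) minkowski \<Rightarrow> complex) set" where
  "null_xray_kernel = {f. \<forall>v\<in>null_directions. \<forall>x. null_xray f v x = 0}"

end

theory Submission
  imports
    Defs
    "HOL-Probability.Characteristic_Functions"
    "HOL-Probability.Sinc_Integral"
    "HOL-Complex_Analysis.Cauchy_Integral_Formula"
    "HOL-Computational_Algebra.Polynomial"
begin

text \<open>
  By the Fourier slice theorem, \<open>R\<^sub>v f = 0\<close> exactly when the Fourier transform of \<open>f\<close> vanishes on
  the hyperplane orthogonal (in the Euclidean sense) to \<open>v\<close>. If both \<open>n\<^sub>1, n\<^sub>2 > 1\<close>, these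
  hyperplanes, for null \<open>v\<close>, cover the whole space; if \<open>n\<^sub>1 = 1 < n\<^sub>2\<close>, they cover exactly the
  vectors outside the open timelike cone, and the analytic Fourier transform of a test function
  vanishes identically once it vanishes there. If \<open>n\<^sub>1 = n\<^sub>2 = 1\<close>, a product of two odd bump
  functions of the null coordinates integrates to zero along every null line.

  Integrals over the hyperplanes are avoided: for \<open>k\<close> orthogonal to \<open>v\<close> one inserts
  \<open>1 = \<integral> \<rho> (y \<bullet> v + t) dt\<close> into the integral defining the Fourier transform and translates by
  \<open>- t v\<close>. Fourier inversion is replaced by pairing with the Gaussians \<open>exp (- |s y|\<^sup>2 / 2)\<close> and
  letting \<open>s\<close> tend to infinity.
\<close>

section \<open>Lebesgue integrals of product functions and changes of variable\<close>

text \<open>\<open>lborel\<close> is the image of the finite product of one-dimensional Lebesgue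
  measures under the map from coordinates to vectors, so both claims reduce to Fubini for finite
  products.\<close>

lemma lborel_prod_component:
  fixes f :: "'a::euclidean_space \<Rightarrow> real \<Rightarrow> 'b::{real_normed_field,banach,second_countable_topology}"
  assumes f: "\<And>b. b \<in> Basis \<Longrightarrow> integrable lborel (f b)"
  shows integrable_lborel_prod: "integrable lborel (\<lambda>x::'a. \<Prod>b\<in>Basis. f b (x \<bullet> b))"
    and integral_lborel_prod:
      "(LINT x|lborel. (\<Prod>b\<in>Basis. f b (x \<bullet> b))) = (\<Prod>b\<in>Basis. LINT t|lborel. f b t)"
proof -
  interpret product_sigma_finite "\<lambda>_::'a. lborel :: real measure"
    by standard
  have m: "(\<lambda>f. \<Sum>b\<in>Basis. f b *\<^sub>R b) \<in> (\<Pi>\<^sub>M b\<in>(Basis::'a set). lborel) \<rightarrow>\<^sub>M borel"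
    by measurable
  have [measurable]: "f b \<in> borel_measurable borel" if "b \<in> Basis" for b
    using borel_measurable_integrable[OF f[OF that]] by simp
  have F: "(\<lambda>x::'a. \<Prod>b\<in>Basis. f b (x \<bullet> b)) \<in> borel_measurable borel"
    by measurable
  have eq: "(\<Prod>b\<in>Basis. f b ((\<Sum>c\<in>Basis. y c *\<^sub>R c) \<bullet> b)) = (\<Prod>b\<in>Basis. f b (y b))" for y :: "'a \<Rightarrow> real"
    by (intro prod.cong) simp_all
  show "integrable lborel (\<lambda>x::'a. \<Prod>b\<in>Basis. f b (x \<bullet> b))"
    unfolding lborel_eq[where 'a='a] integrable_distr_eq[OF m F] eq
    by (intro product_integrable_prod f) simp_all
  show "(LINT x|lborel. (\<Prod>b\<in>Basis. f b (x \<bullet> b))) = (\<Prod>b\<in>Basis. LINT t|lborel. f b t)"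
    unfolding lborel_eq[where 'a='a] integral_distr[OF m F] eq
    by (intro product_integral_prod f) simp_all
qed

lemma integral_lborel_scaleR:
  fixes f :: "'a::euclidean_space \<Rightarrow> 'b::{banach, second_countable_topology}"
  assumes [measurable]: "f \<in> borel_measurable borel" and "c \<noteq> 0"
  shows "(LINT x|lborel. f x) = \<bar>c\<bar> ^ DIM('a) *\<^sub>R (LINT x|lborel. f (c *\<^sub>R x))"
  by (subst lborel_affine[OF \<open>c \<noteq> 0\<close>, of 0]) (simp add: integral_density integral_distr)

lemma integrable_lborel_translation:
  fixes f :: "'a::euclidean_space \<Rightarrow> 'b::{banach, second_countable_topology}"
  assumes "integrable lborel f"
  shows "integrable lborel (\<lambda>x. f (c + x))"
proof -
  have [measurable]: "f \<in> borel_measurable borel"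
    using borel_measurable_integrable[OF assms] by simp
  have "integrable (distr lborel borel ((+) c)) f"
    using assms by (simp add: lborel_distr_plus)
  thus ?thesis by (subst (asm) integrable_distr_eq) auto
qed

lemma integral_lborel_translation:
  fixes f :: "'a::euclidean_space \<Rightarrow> 'b::{banach, second_countable_topology}"
  assumes [measurable]: "f \<in> borel_measurable borel"
  shows "(LINT x|lborel. f (c + x)) = (LINT x|lborel. f x)"
proof -
  have "(LINT x|lborel. f x) = (LINT x|distr lborel borel ((+) c). f x)"
    by (simp add: lborel_distr_plus)
  also have "\<dots> = (LINT x|lborel. f (c + x))"
    by (subst integral_distr) auto
  finally show ?thesis ..
qed

lemma norm_sq_sum_Basis: "(norm (x::'a::euclidean_space))\<^sup>2 = (\<Sum>b\<in>Basis. (x \<bullet> b)\<^sup>2)"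
  by (subst power2_norm_eq_inner, subst euclidean_inner) (simp add: power2_eq_square)

section \<open>The Gaussian and its Fourier transform\<close>

text \<open>Normalized to the value 1 at the origin, not to integral 1: this keeps it bounded by 1,
  as a factor in \<open>slice_average\<close> has to be.\<close>

definition gauss_kernel :: "'a::euclidean_space \<Rightarrow> real" where
  "gauss_kernel x = exp (- (norm x)\<^sup>2 / 2)"

lemma gauss_kernel_eq_prod:
  "gauss_kernel (x::'a::euclidean_space) = sqrt (2 * pi) ^ DIM('a) * (\<Prod>b\<in>Basis. std_normal_density (x \<bullet> b))"
proof -
  have "(\<Prod>b\<in>Basis. std_normal_density (x \<bullet> b))
      = (1 / sqrt (2 * pi)) ^ DIM('a) * exp (\<Sum>b\<in>Basis. - (x \<bullet> b)\<^sup>2 / 2)"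
    by (simp add: std_normal_density_def prod.distrib exp_sum prod_dividef power_divide)
  also have "(\<Sum>b\<in>Basis. - (x \<bullet> b)\<^sup>2 / 2) = - (norm x)\<^sup>2 / 2"
    by (simp add: norm_sq_sum_Basis sum_negf sum_divide_distrib)
  finally show ?thesis
    by (simp add: gauss_kernel_def power_divide)
qed

lemma gauss_kernel_measurable [measurable]: "gauss_kernel \<in> borel_measurable borel"
  unfolding gauss_kernel_def by measurable

lemma gauss_kernel_pos: "gauss_kernel x > 0"
  by (simp add: gauss_kernel_def)

lemma gauss_kernel_le_1: "gauss_kernel x \<le> 1"
  by (simp add: gauss_kernel_def)

lemma integrable_gauss_kernel: "integrable lborel (gauss_kernel :: 'a::euclidean_space \<Rightarrow> real)"
  unfolding gauss_kernel_eq_prod[abs_def]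
  by (intro integrable_mult_right integrable_lborel_prod) (simp add: integrable_normal_density)

lemma integral_gauss_kernel: "(LINT x::'a::euclidean_space|lborel. gauss_kernel x) = sqrt (2 * pi) ^ DIM('a)"
  unfolding gauss_kernel_eq_prod[abs_def]
  by (subst integral_mult_right_zero, subst integral_lborel_prod)
    (simp_all add: integrable_normal_density)

lemma integral_iexp_std_normal_density:
  "(LINT t|lborel. exp (\<i> * complex_of_real (u * t)) * std_normal_density t) = exp (- (u\<^sup>2) / 2)"
proof -
  have "complex_of_real (exp (- (u\<^sup>2) / 2)) = char std_normal_distribution u"
    by (simp add: char_std_normal_distribution)
  also have "\<dots> = (LINT t|lborel. std_normal_density t *\<^sub>R exp (\<i> * complex_of_real (u * t)))"
    unfolding char_def by (subst integral_density) (auto simp: normal_density_nonneg)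
  finally show ?thesis by (simp add: scaleR_conv_of_real mult.commute)
qed

text \<open>The character and the Gaussian both factor over the coordinates; each factor is the
  characteristic function of the standard normal distribution.\<close>

lemma fourier_gauss_kernel:
  fixes w :: "'a::euclidean_space"
  shows "(LINT z|lborel. exp (- (\<i> * complex_of_real (w \<bullet> z))) * complex_of_real (gauss_kernel z))
       = of_real (sqrt (2 * pi) ^ DIM('a) * gauss_kernel w)"
proof -
  let ?f = "\<lambda>b t. exp (\<i> * complex_of_real (- (w \<bullet> b) * t)) * std_normal_density t"
  have int: "integrable lborel (?f b)" for b
    by (rule Bochner_Integration.integrable_bound[where f="std_normal_density"])
       (auto simp: integrable_normal_density norm_mult normal_density_nonneg)
  have "- (\<i> * complex_of_real (w \<bullet> z)) = (\<Sum>b\<in>Basis. \<i> * complex_of_real (- (w \<bullet> b) * (z \<bullet> b)))" for z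
    by (subst euclidean_inner) (simp add: sum_distrib_left sum_negf)
  hence "exp (- (\<i> * complex_of_real (w \<bullet> z))) * complex_of_real (gauss_kernel z) =
     of_real (sqrt (2 * pi) ^ DIM('a)) * (\<Prod>b\<in>Basis. ?f b (z \<bullet> b))" for z
    by (simp add: gauss_kernel_eq_prod prod.distrib exp_sum)
  hence "(LINT z|lborel. exp (- (\<i> * complex_of_real (w \<bullet> z))) * complex_of_real (gauss_kernel z))
    = of_real (sqrt (2 * pi) ^ DIM('a)) * (\<Prod>b\<in>Basis. LINT t|lborel. ?f b t)"
    by (simp only: integral_mult_right_zero integral_lborel_prod[of ?f, OF int])
  also have "(\<Prod>b\<in>Basis. LINT t|lborel. ?f b t) = (\<Prod>b\<in>(Basis::'a set). complex_of_real (exp (- ((w \<bullet> b)\<^sup>2) / 2)))"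
    unfolding integral_iexp_std_normal_density by simp
  also have "\<dots> = of_real (gauss_kernel w)"
    by (simp add: gauss_kernel_def norm_sq_sum_Basis sum_divide_distrib exp_sum
        flip: sum_negf of_real_prod)
  finally show ?thesis by simp
qed

section \<open>Rapidly decreasing functions and their line integrals\<close>

text \<open>Isolates what the analysis takes from the Schwartz condition: continuity and decay of
  the function itself. Differences stay in this class without any reasoning about iterated partial
  derivatives.\<close>

definition rapidly_decreasing :: "('a::euclidean_space \<Rightarrow> complex) \<Rightarrow> bool" where
  "rapidly_decreasing f \<longleftrightarrow>
     continuous_on UNIV f \<and> (\<forall>m. bounded (range (\<lambda>x. norm x ^ m *\<^sub>R f x)))"

lemma rapidly_decreasing_measurable:
  "rapidly_decreasing f \<Longrightarrow> f \<in> borel_measurable borel"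
  by (simp add: rapidly_decreasing_def borel_measurable_continuous_onI)

text \<open>This weight is convenient for domination: the power \<open>DIM('a)\<close> gives
  integrability on the whole space, and the first power gives integrability along lines.\<close>

lemma rapidly_decreasing_bound:
  assumes "rapidly_decreasing f"
  obtains C where "\<And>x. norm (f x) * (1 + (norm x)\<^sup>2) ^ N \<le> C"
proof -
  have bd: "\<exists>B. \<forall>x. norm x ^ m * norm (f x) \<le> B" for m
  proof -
    from assms have "bounded (range (\<lambda>x. norm x ^ m *\<^sub>R f x))"
      unfolding rapidly_decreasing_def by blast
    thus ?thesis by (simp add: bounded_iff)
  qed
  obtain B0 where B0: "\<And>x. norm x ^ 0 * norm (f x) \<le> B0"
    using bd[of 0] by blast
  obtain B1 where B1: "\<And>x. norm x ^ (2 * N) * norm (f x) \<le> B1"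
    using bd[of "2 * N"] by blast
  have pow: "(1 + a) ^ N \<le> 2 ^ N * (1 + a ^ N)" if "a \<ge> 0" for a :: real
  proof (cases "a \<le> 1")
    case True
    hence "(1 + a) ^ N \<le> 2 ^ N" using that by (intro power_mono) auto
    also have "\<dots> \<le> 2 ^ N * (1 + a ^ N)" using that by simp
    finally show ?thesis .
  next
    case False
    hence "(1 + a) ^ N \<le> (2 * a) ^ N" using that by (intro power_mono) auto
    also have "\<dots> \<le> 2 ^ N * (1 + a ^ N)" using that by (simp add: power_mult_distrib)
    finally show ?thesis .
  qed
  have "norm (f x) * (1 + (norm x)\<^sup>2) ^ N \<le> 2 ^ N * (B0 + B1)" for x
  proof -
    have "norm (f x) * (1 + (norm x)\<^sup>2) ^ N \<le> norm (f x) * (2 ^ N * (1 + ((norm x)\<^sup>2) ^ N))"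
      by (intro mult_left_mono pow) auto
    also have "\<dots> = 2 ^ N * (norm x ^ 0 * norm (f x) + norm x ^ (2 * N) * norm (f x))"
      by (simp add: algebra_simps flip: power_mult)
    also have "\<dots> \<le> 2 ^ N * (B0 + B1)"
      by (intro mult_left_mono add_mono B0 B1) auto
    finally show ?thesis .
  qed
  thus ?thesis using that by blast
qed

lemma integrable_inverse_1_plus_square_lborel:
  "integrable lborel (\<lambda>t::real. inverse (1 + t\<^sup>2))"
  using integrable_inverse_1_plus_square
  by (simp add: set_integrable_def einterval_def)

text \<open>Each coordinate is bounded by the norm, so the weight with exponent
  \<open>DIM('a)\<close> dominates the product of the weights 1 + (x . b)^2, whose reciprocal is
  integrable coordinate by coordinate.\<close>

lemma rapidly_decreasing_integrable:
  fixes f :: "'a::euclidean_space \<Rightarrow> complex"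
  assumes f: "rapidly_decreasing f"
  shows "integrable lborel f"
proof -
  obtain C where C: "\<And>x. norm (f x) * (1 + (norm x)\<^sup>2) ^ DIM('a) \<le> C"
    using rapidly_decreasing_bound[OF f] by blast
  have bound: "norm (f x) \<le> norm (C * (\<Prod>b\<in>Basis. inverse (1 + (x \<bullet> b)\<^sup>2)))" for x
  proof -
    have p: "0 < 1 + (x \<bullet> b)\<^sup>2" for b by (simp add: add_pos_nonneg)
    have pos: "0 < (\<Prod>b\<in>Basis. (1 + (x \<bullet> b)\<^sup>2))"
      using p by (intro prod_pos) auto
    have "(\<Prod>b\<in>Basis. (1 + (x \<bullet> b)\<^sup>2)) \<le> (\<Prod>b\<in>(Basis::'a set). (1 + (norm x)\<^sup>2))"
      using Basis_le_norm[of _ x] by (intro prod_mono) (auto intro: power2_le_iff_abs_le[THEN iffD2])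
    also have "\<dots> = (1 + (norm x)\<^sup>2) ^ DIM('a)" by simp
    finally have "norm (f x) * (\<Prod>b\<in>Basis. (1 + (x \<bullet> b)\<^sup>2)) \<le> C"
      using C[of x] mult_left_mono norm_ge_zero order_trans by blast
    hence "norm (f x) \<le> C * inverse (\<Prod>b\<in>Basis. (1 + (x \<bullet> b)\<^sup>2))"
      using pos by (simp add: field_simps)
    thus ?thesis by (simp flip: prod_inversef)
  qed
  have int: "integrable lborel (\<lambda>x::'a. C * (\<Prod>b\<in>Basis. inverse (1 + (x \<bullet> b)\<^sup>2)))"
    by (intro integrable_mult_right integrable_lborel_prod integrable_inverse_1_plus_square_lborel)
  show ?thesis
    by (rule Bochner_Integration.integrable_bound[OF int])
      (use bound rapidly_decreasing_measurable[OF f] in simp_all)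
qed

lemma rapidly_decreasing_bounded:
  assumes "rapidly_decreasing f"
  shows "bounded (range f)"
proof -
  have "bounded (range (\<lambda>x. norm x ^ 0 *\<^sub>R f x))"
    using assms unfolding rapidly_decreasing_def by blast
  thus ?thesis by simp
qed

lemma rapidly_decreasing_diff:
  assumes "rapidly_decreasing f" "rapidly_decreasing g"
  shows "rapidly_decreasing (\<lambda>x. f x - g x)"
  unfolding rapidly_decreasing_def
proof (intro conjI allI)
  show "continuous_on UNIV (\<lambda>x. f x - g x)"
    using assms by (intro continuous_on_diff) (auto simp: rapidly_decreasing_def)
  show "bounded (range (\<lambda>x. norm x ^ m *\<^sub>R (f x - g x)))" for m
    unfolding scaleR_diff_right
    using assms by (intro bounded_minus_comp) (auto simp: rapidly_decreasing_def)
qed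

text \<open>By Pythagoras, a base point orthogonal to \<open>v\<close> gives norm (x + t v) >= |t|.
  The constant is therefore uniform in \<open>x\<close>, which dominated convergence needs when the
  line moves.\<close>

lemma rapidly_decreasing_line_bound:
  fixes f :: "real ^ 'k::finite \<Rightarrow> complex"
  assumes f: "rapidly_decreasing f" and v: "norm v = 1"
  obtains C where "\<And>x t. x \<bullet> v = 0 \<Longrightarrow> norm (f (x + t *\<^sub>R v)) \<le> C * inverse (1 + t\<^sup>2)"
proof -
  obtain C where C: "\<And>x. norm (f x) * (1 + (norm x)\<^sup>2) ^ 1 \<le> C"
    using rapidly_decreasing_bound[OF f] by blast
  have "norm (f (x + t *\<^sub>R v)) \<le> C * inverse (1 + t\<^sup>2)" if "x \<bullet> v = 0" for x t
  proof -
    have "(norm (x + t *\<^sub>R v))\<^sup>2 = (norm x)\<^sup>2 + t\<^sup>2"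
      using that v by (simp add: norm_add_Pythagorean orthogonal_def)
    hence "norm (f (x + t *\<^sub>R v)) * (1 + t\<^sup>2) \<le> norm (f (x + t *\<^sub>R v)) * (1 + (norm (x + t *\<^sub>R v))\<^sup>2) ^ 1"
      by (intro mult_left_mono) auto
    also note C
    finally show ?thesis by (simp add: field_simps add_pos_nonneg)
  qed
  thus ?thesis using that by blast
qed

lemma line_integral_shift:
  "line_integral v f (x + s *\<^sub>R v) = line_integral v f x"
  unfolding line_integral_def
  by (subst (2) lborel_integral_real_affine[of 1 _ s]) (simp_all add: algebra_simps)

lemma rapidly_decreasing_integrable_line:
  fixes f :: "real ^ 'k::finite \<Rightarrow> complex"
  assumes f: "rapidly_decreasing f" and v: "norm v = 1"
  shows "integrable lborel (\<lambda>t. f (x + t *\<^sub>R v))"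
proof -
  \<comment> \<open>The foot of the perpendicular from the origin to the line; passing from
    \<open>x\<close> to \<open>p\<close> only shifts the parameter \<open>t\<close>.\<close>
  define p where "p = x - (x \<bullet> v) *\<^sub>R v"
  have p: "p \<bullet> v = 0" using v by (simp add: p_def inner_diff_left power2_norm_eq_inner[symmetric] flip: norm_eq_1)
  have [measurable]: "f \<in> borel_measurable borel" by (rule rapidly_decreasing_measurable[OF f])
  obtain C where C: "\<And>x t. x \<bullet> v = 0 \<Longrightarrow> norm (f (x + t *\<^sub>R v)) \<le> C * inverse (1 + t\<^sup>2)"
    using rapidly_decreasing_line_bound[OF f v] by blast
  have "integrable lborel (\<lambda>t. f (p + t *\<^sub>R v))"
  proof (rule Bochner_Integration.integrable_bound)
    show "integrable lborel (\<lambda>t. C * inverse (1 + t\<^sup>2))"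
      by (intro integrable_mult_right integrable_inverse_1_plus_square_lborel)
    show "AE t in lborel. norm (f (p + t *\<^sub>R v)) \<le> norm (C * inverse (1 + t\<^sup>2))"
      using C[OF p] by (auto intro: order_trans[OF _ abs_ge_self])
  qed measurable
  from lborel_integrable_real_affine[OF this, of 1 "x \<bullet> v"] show ?thesis
    by (simp add: p_def algebra_simps)
qed

lemma line_integral_continuous_bounded:
  fixes f :: "real ^ 'k::finite \<Rightarrow> complex"
  assumes f: "rapidly_decreasing f" and v: "norm v = 1"
  shows continuous_line_integral: "continuous_on UNIV (line_integral v f)"
    and bounded_line_integral: "bounded (range (line_integral v f))"
proof -
  \<comment> \<open>Projecting the base point to the hyperplane orthogonal to \<open>v\<close>
    leaves the line integral unchanged and makes one integrable bound valid for all lines.\<close>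
  define P where "P x = x - (x \<bullet> v) *\<^sub>R v" for x
  have P: "P x \<bullet> v = 0" for x using v by (simp add: P_def inner_diff_left flip: norm_eq_1)
  have eq: "line_integral v f x = (LINT t|lborel. f (P x + t *\<^sub>R v))" for x
    using line_integral_shift[of v f "P x" "x \<bullet> v"] by (simp add: P_def line_integral_def)
  have [measurable]: "f \<in> borel_measurable borel" by (rule rapidly_decreasing_measurable[OF f])
  have cont: "continuous_on UNIV f" using f by (simp add: rapidly_decreasing_def)
  obtain C where C: "\<And>x t. x \<bullet> v = 0 \<Longrightarrow> norm (f (x + t *\<^sub>R v)) \<le> C * inverse (1 + t\<^sup>2)"
    using rapidly_decreasing_line_bound[OF f v] by blast
  have int: "integrable lborel (\<lambda>t. C * inverse (1 + t\<^sup>2))"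
    by (intro integrable_mult_right integrable_inverse_1_plus_square_lborel)
  have "(\<lambda>n. line_integral v f (X n)) \<longlonglongrightarrow> line_integral v f x" if "X \<longlonglongrightarrow> x" for X x
    unfolding eq
  proof (rule integral_dominated_convergence)
    show "integrable lborel (\<lambda>t. C * inverse (1 + t\<^sup>2))" by (rule int)
    show "AE t in lborel. (\<lambda>n. f (P (X n) + t *\<^sub>R v)) \<longlonglongrightarrow> f (P x + t *\<^sub>R v)"
    proof (rule AE_I2)
      fix t
      have "(\<lambda>n. P (X n) + t *\<^sub>R v) \<longlonglongrightarrow> P x + t *\<^sub>R v"
        unfolding P_def by (intro tendsto_intros that)
      moreover have "isCont f (P x + t *\<^sub>R v)" using cont by (simp add: continuous_on_eq_continuous_at)
      ultimately show "(\<lambda>n. f (P (X n) + t *\<^sub>R v)) \<longlonglongrightarrow> f (P x + t *\<^sub>R v)"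
        by (rule isCont_tendsto_compose[rotated])
    qed
  qed (use C P in auto)
  thus "continuous_on UNIV (line_integral v f)"
    by (auto simp: continuous_on_sequentially comp_def)
  have "norm (line_integral v f x) \<le> (LINT t|lborel. C * inverse (1 + t\<^sup>2))" for x
    unfolding eq
    by (intro Bochner_Integration.integral_norm_bound_integral int rapidly_decreasing_integrable_line f v C P)
  thus "bounded (range (line_integral v f))" by (auto simp: bounded_iff)
qed

section \<open>The Fourier slice theorem, its converse and Fourier injectivity\<close>

text \<open>Stands in for integrating first along lines parallel to \<open>v\<close> and then over
  the orthogonal hyperplane: both \<open>E\<close> and the line integral are constant along
  \<open>v\<close>, so a probability density in the variable y . v recovers the hyperplane
  integral.\<close>

lemma slice_average:
  fixes f E :: "real ^ 'k::finite \<Rightarrow> complex" and \<rho> :: "real \<Rightarrow> real"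
  assumes f: "integrable lborel f"
    and E [measurable]: "E \<in> borel_measurable borel" and E_le: "\<And>y. norm (E y) \<le> 1"
    and E_inv: "\<And>y t. E (y + t *\<^sub>R v) = E y"
    and v: "norm v = 1"
    and \<rho>: "integrable lborel \<rho>" "\<And>t. \<rho> t \<ge> 0" "(LINT t|lborel. \<rho> t) = 1"
  shows "(LINT y|lborel. f y * E y) = (LINT y|lborel. E y * \<rho> (y \<bullet> v) * line_integral v f y)"
proof -
  have [measurable]: "f \<in> borel_measurable borel" "\<rho> \<in> borel_measurable borel"
    using borel_measurable_integrable[OF f] borel_measurable_integrable[OF \<rho>(1)] by simp_all
  have vv: "v \<bullet> v = 1" using v by (simp flip: norm_eq_1)
  have \<rho>': "integrable lborel (\<lambda>t. \<rho> (c + t))" "(LINT t|lborel. \<rho> (c + t)) = 1" for c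
    using lborel_integrable_real_affine[OF \<rho>(1), of 1 c]
      lborel_integral_real_affine[of 1 \<rho> c] \<rho>(3) by simp_all
  have fE: "integrable lborel (\<lambda>y. f y * E y)"
    using E_le by (intro Bochner_Integration.integrable_bound[OF f]) (auto simp: norm_mult mult_left_le)
  \<comment> \<open>\<open>H\<close> is the integrand after inserting the integral of the density,
    which is 1. \<open>K\<close> is \<open>H\<close> translated by - t v: this removes
    \<open>t\<close> from the argument of \<open>\<rho>\<close>, leaves \<open>E\<close> unchanged
    and puts \<open>t\<close> into \<open>f\<close> alone, so that integrating over \<open>t\<close>
    produces the line integral.\<close>
  define H where "H t y = f y * E y * \<rho> (y \<bullet> v + t)" for t y
  define K where "K t y = f (y - t *\<^sub>R v) * E y * \<rho> (y \<bullet> v)" for t y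
  have [measurable]: "case_prod H \<in> borel_measurable (lborel \<Otimes>\<^sub>M lborel)"
    "case_prod K \<in> borel_measurable (lborel \<Otimes>\<^sub>M lborel)"
    unfolding H_def K_def case_prod_beta' by measurable
  have E_inv': "E (y - t *\<^sub>R v) = E y" for y t
    using E_inv[of y "-t"] by simp
  have K: "K t y = H t (- (t *\<^sub>R v) + y)" for t y
    using vv E_inv'[of y t] by (simp add: K_def H_def inner_diff_left)
  have "integrable (lborel \<Otimes>\<^sub>M lborel) (\<lambda>(y, t). H t y)"
  proof (rule lborel_pair.Fubini_integrable)
    show "(\<lambda>(y, t). H t y) \<in> borel_measurable (lborel \<Otimes>\<^sub>M lborel)"
      unfolding H_def case_prod_beta' by measurable
    show "AE y in lborel. integrable lborel (\<lambda>t. case (y, t) of (y, t) \<Rightarrow> H t y)"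
      using \<rho>' by (auto simp: H_def)
    have "(LINT t|lborel. norm (H t y)) = norm (f y * E y)" for y
      using \<rho>'[of "y \<bullet> v"] \<rho>(2) by (simp add: H_def norm_mult)
    thus "integrable lborel (\<lambda>y. LINT t|lborel. norm (case (y, t) of (y, t) \<Rightarrow> H t y))"
      using fE by simp
  qed
  from lborel_pair.integrable_product_swap[OF this]
  have H_int: "integrable (lborel \<Otimes>\<^sub>M lborel) (case_prod H)"
    by (simp add: case_prod_beta')
  \<comment> \<open>For fixed \<open>t\<close>, \<open>K t\<close> is a translate of
    \<open>H t\<close>; integrability and the integral of the norm carry over slice by
    slice.\<close>
  have K_int: "integrable (lborel \<Otimes>\<^sub>M lborel) (case_prod K)"
  proof (rule lborel_pair.Fubini_integrable)
    have "AE t in lborel. integrable lborel (H t)"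
      using lborel_pair.AE_integrable_fst'[OF H_int] by simp
    thus "AE t in lborel. integrable lborel (\<lambda>y. case_prod K (t, y))"
      by eventually_elim (simp only: prod.case K integrable_lborel_translation)
    have "(LINT y|lborel. norm (K t y)) = (LINT y|lborel. norm (H t y))" for t
      unfolding K by (rule integral_lborel_translation) (simp add: H_def)
    moreover have "integrable (lborel \<Otimes>\<^sub>M lborel) (\<lambda>(t, y). norm (H t y))"
      using H_int[THEN integrable_norm] by (simp add: case_prod_beta')
    from lborel_pair.integrable_fst[OF this]
    have "integrable lborel (\<lambda>t. LINT y|lborel. norm (H t y))" .
    ultimately show "integrable lborel (\<lambda>t. LINT y|lborel. norm (case_prod K (t, y)))"
      by simp
  qed measurable
  have K_inner: "(LINT t|lborel. K t y) = E y * \<rho> (y \<bullet> v) * line_integral v f y" for y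
  proof -
    have "(LINT t|lborel. K t y) = (LINT t|lborel. E y * \<rho> (y \<bullet> v) * f (y - t *\<^sub>R v))"
      by (simp add: K_def mult_ac)
    also have "\<dots> = E y * \<rho> (y \<bullet> v) * (LINT t|lborel. f (y - t *\<^sub>R v))"
      by (rule integral_mult_right_zero)
    also have "(LINT t|lborel. f (y - t *\<^sub>R v)) = line_integral v f y"
      unfolding line_integral_def by (subst lborel_integral_real_affine[of "-1" _ 0]) simp_all
    finally show ?thesis .
  qed
  have "(LINT y|lborel. f y * E y) = (LINT y|lborel. LINT t|lborel. H t y)"
    using \<rho>' by (simp add: H_def)
  also have "\<dots> = (LINT t|lborel. LINT y|lborel. H t y)"
    by (rule lborel_pair.Fubini_integral[OF H_int])
  also have "\<dots> = (LINT t|lborel. LINT y|lborel. K t y)"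
    unfolding K by (subst integral_lborel_translation) (auto simp: H_def)
  also have "\<dots> = (LINT y|lborel. LINT t|lborel. K t y)"
    by (rule lborel_pair.Fubini_integral[OF K_int, symmetric])
  finally show ?thesis by (simp only: K_inner)
qed

text \<open>The substitution u = s y turns the hypothesis into the vanishing of the integral of g (u
  / s) against the fixed Gaussian. Letting s tend to infinity leaves g 0 times the nonzero Gaussian
  mass; boundedness of \<open>g\<close> gives the dominating function.\<close>

lemma gauss_localization:
  fixes g :: "'a::euclidean_space \<Rightarrow> complex"
  assumes g: "continuous_on UNIV g" "bounded (range g)"
    and zero: "\<And>s. s > 0 \<Longrightarrow> (LINT y|lborel. g y * gauss_kernel (s *\<^sub>R y)) = 0"
  shows "g 0 = 0"
proof -
  have [measurable]: "g \<in> borel_measurable borel" by (intro borel_measurable_continuous_onI g)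
  obtain C where C: "\<And>x. norm (g x) \<le> C" using g(2) by (auto simp: bounded_iff)
  have eq: "(LINT u|lborel. g (inverse (real (Suc n)) *\<^sub>R u) * gauss_kernel u) = 0" for n
    using zero[of "real (Suc n)"] by (subst integral_lborel_scaleR[where c="real (Suc n)"]) simp_all
  have "(\<lambda>n. LINT u|lborel. g (inverse (real (Suc n)) *\<^sub>R u) * gauss_kernel u)
      \<longlonglongrightarrow> (LINT u|lborel. g 0 * gauss_kernel (u::'a))"
  proof (rule integral_dominated_convergence)
    show "integrable lborel (\<lambda>u::'a. C * gauss_kernel u)"
      by (intro integrable_mult_right integrable_gauss_kernel)
    show "AE u in lborel. (\<lambda>n. g (inverse (real (Suc n)) *\<^sub>R u) * gauss_kernel u)
      \<longlonglongrightarrow> g 0 * gauss_kernel u"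
    proof (intro AE_I2 tendsto_intros)
      fix u :: 'a
      have "(\<lambda>n. inverse (real (Suc n)) *\<^sub>R u) \<longlonglongrightarrow> 0 *\<^sub>R u"
        by (rule tendsto_scaleR[OF LIMSEQ_inverse_real_of_nat tendsto_const])
      thus "(\<lambda>n. g (inverse (real (Suc n)) *\<^sub>R u)) \<longlonglongrightarrow> g 0"
        using g(1) by (intro isCont_tendsto_compose[of 0 g]) (auto simp: continuous_on_eq_continuous_at)
    qed
    show "AE u in lborel. norm (g (inverse (real (Suc n)) *\<^sub>R u) * gauss_kernel u) \<le> C * gauss_kernel u" for n
      using C by (intro AE_I2) (simp add: norm_mult less_imp_le gauss_kernel_pos mult_right_mono)
  qed auto
  hence "(LINT u|lborel. g 0 * complex_of_real (gauss_kernel (u::'a))) = 0"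
    unfolding eq by (simp add: LIMSEQ_const_iff)
  thus ?thesis by (simp add: integral_gauss_kernel)
qed

text \<open>Up to a constant, gauss_kernel (B y) is the Fourier transform of the Gaussian at B y.
  Fubini and the adjointness of \<open>A\<close> and \<open>B\<close> move the transform onto
  \<open>f\<close>, evaluated on the range of \<open>A\<close> only. Scalings and scaled projections
  onto a hyperplane are the two choices made below.\<close>

lemma fourier_gauss_pairing:
  fixes f :: "real ^ 'k::finite \<Rightarrow> complex" and A B :: "real ^ 'k \<Rightarrow> real ^ 'k"
  assumes f: "integrable lborel f" and A [measurable]: "A \<in> borel_measurable borel"
    and adj: "\<And>z y. A z \<bullet> y = B y \<bullet> z"
    and zero: "\<And>z. fourier_transform f (A z) = 0"
  shows "(LINT y|lborel. f y * gauss_kernel (B y)) = 0"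
proof -
  have [measurable]: "f \<in> borel_measurable borel"
    using borel_measurable_integrable[OF f] by simp
  define H where "H z y = exp (- (\<i> * complex_of_real (A z \<bullet> y))) * f y * gauss_kernel z" for z y
  let ?c = "complex_of_real (sqrt (2 * pi) ^ CARD('k))"
  have norm_H: "norm (H z y) = norm (f y) * gauss_kernel z" for z y
    using gauss_kernel_pos[of z] by (simp add: H_def norm_mult less_imp_le)
  have int: "integrable (lborel \<Otimes>\<^sub>M lborel) (case_prod H)"
  proof (rule lborel_pair.Fubini_integrable)
    show "case_prod H \<in> borel_measurable (lborel \<Otimes>\<^sub>M lborel)"
      unfolding H_def case_prod_beta' by measurable
    show "integrable lborel (\<lambda>z. LINT y|lborel. norm (case_prod H (z, y)))"
      by (simp add: norm_H integrable_gauss_kernel)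
    show "AE z in lborel. integrable lborel (\<lambda>y. case_prod H (z, y))"
    proof (rule AE_I2, rule Bochner_Integration.integrable_bound)
      fix z :: "real ^ 'k"
      show "integrable lborel (\<lambda>y. f y * gauss_kernel z)"
        by (intro integrable_mult_left f)
      show "AE y in lborel. norm (case_prod H (z, y)) \<le> norm (f y * gauss_kernel z)"
        by (simp add: norm_H norm_mult less_imp_le gauss_kernel_pos)
    qed (simp add: H_def)
  qed
  have H_zero: "(LINT y|lborel. H z y) = 0" for z
    using zero[of z] by (simp add: H_def fourier_transform_def)
  have H_inner: "(LINT z|lborel. H z y) = ?c * (f y * gauss_kernel (B y))" for y
  proof -
    have "(LINT z|lborel. H z y)
        = (LINT z|lborel. f y * (exp (- (\<i> * complex_of_real (B y \<bullet> z))) * gauss_kernel z))"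
      by (simp add: H_def adj mult_ac)
    also have "\<dots> = f y * (LINT z|lborel. exp (- (\<i> * complex_of_real (B y \<bullet> z))) * gauss_kernel z)"
      by (rule integral_mult_right_zero)
    finally show ?thesis by (simp add: fourier_gauss_kernel)
  qed
  have "0 = (LINT z|lborel. LINT y|lborel. H z y)" by (simp add: H_zero)
  also have "\<dots> = (LINT y|lborel. LINT z|lborel. H z y)"
    by (rule lborel_pair.Fubini_integral[OF int, symmetric])
  also have "\<dots> = (LINT y|lborel. ?c * (f y * gauss_kernel (B y)))"
    by (simp only: H_inner)
  also have "\<dots> = ?c * (LINT y|lborel. f y * gauss_kernel (B y))"
    by (rule integral_mult_right_zero)
  finally show ?thesis by simp
qed

text \<open>For \<open>k\<close> orthogonal to \<open>v\<close> the character is constant along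
  \<open>v\<close>, so it can take the role of \<open>E\<close> in
  \<open>slice_average\<close>.\<close>

lemma fourier_slice:
  fixes f :: "real ^ 'k::finite \<Rightarrow> complex"
  assumes f: "integrable lborel f" and v: "norm v = 1"
    and zero: "\<And>x. line_integral v f x = 0" and k: "k \<bullet> v = 0"
  shows "fourier_transform f k = 0"
proof -
  have "fourier_transform f k = (LINT y|lborel. f y * exp (- (\<i> * complex_of_real (k \<bullet> y))))"
    by (simp add: fourier_transform_def mult.commute)
  also have "\<dots> = (LINT y|lborel. exp (- (\<i> * complex_of_real (k \<bullet> y))) * std_normal_density (y \<bullet> v) *
      line_integral v f y)"
    by (rule slice_average[OF f])
      (simp_all add: v k inner_add_right integrable_normal_density normal_density_nonneg)
  finally show ?thesis by (simp add: zero)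
qed

text \<open>Translation multiplies the transform by a phase and so keeps its zeros. This moves any
  point of interest to the origin, where \<open>gauss_localization\<close> applies.\<close>

lemma fourier_translation:
  fixes f :: "real ^ 'k::finite \<Rightarrow> complex"
  assumes f: "f \<in> borel_measurable borel"
  shows "fourier_transform (\<lambda>y. f (x + y)) k = exp (\<i> * complex_of_real (k \<bullet> x)) * fourier_transform f k"
proof -
  note [measurable] = f
  let ?G = "\<lambda>u. exp (\<i> * complex_of_real (k \<bullet> x)) * (exp (- (\<i> * complex_of_real (k \<bullet> u))) * f u)"
  have "fourier_transform (\<lambda>y. f (x + y)) k = (LINT y|lborel. ?G (x + y))"
    by (simp add: fourier_transform_def inner_add_right algebra_simps flip: exp_add mult.assoc)
  also have "\<dots> = (LINT u|lborel. ?G u)"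
    by (rule integral_lborel_translation) measurable
  finally show ?thesis by (simp add: fourier_transform_def)
qed

text \<open>A Gaussian of the component orthogonal to \<open>v\<close> pairs to zero with
  \<open>f\<close>, since it only involves frequencies orthogonal to \<open>v\<close>. Averaging
  along \<open>v\<close> with a one-dimensional normal density completes it to the full Gaussian of
  s y, now paired with the line integral, which is then localized at a point.\<close>

lemma fourier_slice_converse:
  fixes f :: "real ^ 'k::finite \<Rightarrow> complex"
  assumes f: "rapidly_decreasing f" and v: "norm v = 1"
    and zero: "\<And>k. k \<bullet> v = 0 \<Longrightarrow> fourier_transform f k = 0"
  shows "line_integral v f x = 0"
proof -
  have vv: "v \<bullet> v = 1" using v by (simp flip: norm_eq_1)
  define F where "F = (\<lambda>y. f (x + y))"
  have F: "integrable lborel F"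
    unfolding F_def by (intro integrable_lborel_translation rapidly_decreasing_integrable f)
  have F_zero: "fourier_transform F k = 0" if "k \<bullet> v = 0" for k
    unfolding F_def using zero[OF that] by (simp add: fourier_translation rapidly_decreasing_measurable f)
  have line_F: "line_integral v F = (\<lambda>y. line_integral v f (x + y))"
    by (simp add: line_integral_def F_def add.assoc fun_eq_iff)
  have "line_integral v F 0 = 0"
  proof (rule gauss_localization)
    show "continuous_on UNIV (line_integral v F)"
      unfolding line_F by (rule continuous_on_compose2[OF continuous_line_integral[OF f v]])
        (auto intro!: continuous_intros)
    show "bounded (range (line_integral v F))"
      unfolding line_F by (rule bounded_subset[OF bounded_line_integral[OF f v]]) auto
    fix s :: real assume s: "s > 0"
    \<comment> \<open>\<open>s\<close> times the orthogonal projection along \<open>v\<close>: it is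
      symmetric, hence its own adjoint, and its values are frequencies where the transform of
      \<open>F\<close> vanishes. \<open>c\<close> is the normalizing constant of the normal density
      with standard deviation 1 / s.\<close>
    define A where "A z = s *\<^sub>R (z - (z \<bullet> v) *\<^sub>R v)" for z
    define c where "c = s / sqrt (2 * pi)"
    have c: "c \<noteq> 0" using s by (simp add: c_def)
    have [measurable]: "A \<in> borel_measurable borel"
      unfolding A_def by (intro borel_measurable_continuous_onI continuous_intros)
    \<comment> \<open>Pythagoras splits the exponent of the Gaussian of s y. The summand 0 in the
      argument of the density gives it the shape of the affine substitution rules for
      \<open>lborel\<close>.\<close>
    have kernel: "complex_of_real (gauss_kernel (A y)) * complex_of_real (s * std_normal_density (0 + s * (y \<bullet> v)))
        * line_integral v F y = of_real c * (line_integral v F y * gauss_kernel (s *\<^sub>R y))" for y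
    proof -
      have "norm y ^ 2 = norm (y - (y \<bullet> v) *\<^sub>R v) ^ 2 + (y \<bullet> v)\<^sup>2"
        unfolding power2_norm_eq_inner
        by (simp add: inner_diff_left inner_diff_right vv inner_commute power2_eq_square)
      moreover have "norm (A y) ^ 2 = s\<^sup>2 * norm (y - (y \<bullet> v) *\<^sub>R v) ^ 2"
        by (simp add: A_def power_mult_distrib)
      ultimately have real_eq: "gauss_kernel (A y) * (s * std_normal_density (0 + s * (y \<bullet> v))) = c * gauss_kernel (s *\<^sub>R y)"
        by (simp add: c_def gauss_kernel_def std_normal_density_def power_mult_distrib algebra_simps
              add_divide_distrib flip: exp_add)
      have "complex_of_real (gauss_kernel (A y)) * complex_of_real (s * std_normal_density (0 + s * (y \<bullet> v)))
          = complex_of_real c * complex_of_real (gauss_kernel (s *\<^sub>R y))"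
        by (simp only: real_eq flip: of_real_mult)
      thus ?thesis by (simp only: mult_ac)
    qed
    have "0 = (LINT y|lborel. F y * gauss_kernel (A y))"
      by (rule fourier_gauss_pairing[OF F, where A = A, symmetric])
        (auto simp: A_def inner_diff_left inner_diff_right vv inner_commute mult_ac intro!: F_zero)
    also have "\<dots> = (LINT y|lborel. complex_of_real (gauss_kernel (A y)) *
        complex_of_real (s * std_normal_density (0 + s * (y \<bullet> v))) * line_integral v F y)"
    proof (rule slice_average[OF F _ _ _ v, where \<rho> = "\<lambda>t. s * std_normal_density (0 + s * t)"])
      show "integrable lborel (\<lambda>t. s * std_normal_density (0 + s * t))"
        using s by (intro integrable_mult_right lborel_integrable_real_affine integrable_normal_density) auto
      show "(LINT t|lborel. s * std_normal_density (0 + s * t)) = 1"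
        using lborel_integral_real_affine[of s std_normal_density 0] s by (simp add: integral_normal_density)
      show "s * std_normal_density (0 + s * t) \<ge> 0" for t
        using s by (simp add: normal_density_nonneg)
      show "complex_of_real (gauss_kernel (A (y + t *\<^sub>R v))) = complex_of_real (gauss_kernel (A y))" for y t
        by (simp add: A_def inner_add_left vv algebra_simps)
    qed (auto simp: gauss_kernel_le_1 less_imp_le gauss_kernel_pos)
    also have "\<dots> = of_real c * (LINT y|lborel. line_integral v F y * gauss_kernel (s *\<^sub>R y))"
      unfolding kernel by (rule integral_mult_right_zero)
    finally show "(LINT y|lborel. line_integral v F y * gauss_kernel (s *\<^sub>R y)) = 0"
      using c by simp
  qed
  thus ?thesis by (simp add: line_F)
qed

text \<open>Same scheme with the scaling by \<open>s\<close> in place of the projection: all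
  frequencies are available, so the translate of \<open>f\<close> itself pairs to zero with every
  Gaussian.\<close>

lemma fourier_injective:
  fixes f :: "real ^ 'k::finite \<Rightarrow> complex"
  assumes f: "rapidly_decreasing f" and zero: "\<And>k. fourier_transform f k = 0"
  shows "f x = 0"
proof -
  have "f (x + 0) = 0"
  proof (rule gauss_localization[where g="\<lambda>y. f (x + y)"])
    show "continuous_on UNIV (\<lambda>y. f (x + y))"
      using f by (auto simp: rapidly_decreasing_def intro!: continuous_on_compose2[of UNIV f] continuous_intros)
    show "bounded (range (\<lambda>y. f (x + y)))"
      by (rule bounded_subset[OF rapidly_decreasing_bounded[OF f]]) auto
    show "(LINT y|lborel. f (x + y) * gauss_kernel (s *\<^sub>R y)) = 0" for s
    proof (rule fourier_gauss_pairing[where A="\<lambda>z. s *\<^sub>R z"])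
      show "integrable lborel (\<lambda>y. f (x + y))"
        by (intro integrable_lborel_translation rapidly_decreasing_integrable f)
    qed (auto simp: inner_commute fourier_translation zero rapidly_decreasing_measurable f)
  qed
  thus ?thesis by simp
qed

section \<open>Continuity and unique continuation of the Fourier transform\<close>

lemma continuous_fourier_transform:
  fixes f :: "real ^ 'k::finite \<Rightarrow> complex"
  assumes f: "integrable lborel f"
  shows "continuous_on UNIV (fourier_transform f)"
proof -
  have [measurable]: "f \<in> borel_measurable borel"
    using borel_measurable_integrable[OF f] by simp
  have "(\<lambda>n. fourier_transform f (X n)) \<longlonglongrightarrow> fourier_transform f k" if "X \<longlonglongrightarrow> k" for X k
    unfolding fourier_transform_def
  proof (rule integral_dominated_convergence)
    show "integrable lborel (\<lambda>y. norm (f y))" using f by simp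
    show "AE y in lborel. (\<lambda>n. exp (- (\<i> * complex_of_real (X n \<bullet> y))) * f y)
        \<longlonglongrightarrow> exp (- (\<i> * complex_of_real (k \<bullet> y))) * f y"
      by (intro AE_I2 tendsto_intros that)
  qed (auto simp: norm_mult)
  thus ?thesis by (auto simp: continuous_on_sequentially comp_def)
qed

text \<open>Bounded support makes the restriction of the transform to the line k0 + t w a power
  series in \<open>t\<close>, convergent for every complex \<open>t\<close>. It vanishes for small
  real \<open>t\<close>, so all its coefficients are zero, and t = 1 gives the value at
  \<open>k\<close>.\<close>

lemma fourier_unique_continuation:
  fixes f :: "real ^ 'k::finite \<Rightarrow> complex"
  assumes f: "integrable lborel f" and supp: "\<And>y. f y \<noteq> 0 \<Longrightarrow> norm y \<le> R"
    and U: "open U" "k0 \<in> U" and zero: "\<And>k. k \<in> U \<Longrightarrow> fourier_transform f k = 0"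
  shows "fourier_transform f k = 0"
proof -
  have [measurable]: "f \<in> borel_measurable borel"
    using borel_measurable_integrable[OF f] by simp
  define w where "w = k - k0"
  \<comment> \<open>At k0 + t w the integrand of the transform is h y times an exponential in
    \<open>t\<close>. \<open>F\<close> admits complex \<open>t\<close>, \<open>T n\<close> is the
    n-th Taylor coefficient of the integrand, and \<open>M\<close> bounds |w . y| wherever
    \<open>f\<close> is nonzero.\<close>
  define h where "h y = exp (- (\<i> * complex_of_real (k0 \<bullet> y))) * f y" for y
  define T where "T n y = h y * ((- (\<i> * complex_of_real (w \<bullet> y))) ^ n / fact n)" for n y
  define F where "F t = (LINT y|lborel. h y * exp (t * - (\<i> * complex_of_real (w \<bullet> y))))" for t :: complex
  define M where "M = norm w * \<bar>R\<bar>"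
  have [measurable]: "h \<in> borel_measurable borel" "T n \<in> borel_measurable borel" for n
    unfolding h_def T_def by measurable
  have norm_T: "norm (T n y * t ^ n) \<le> norm (f y) * ((M * norm t) ^ n / fact n)" for n y t
  proof (cases "f y = 0")
    case False
    have "\<bar>w \<bullet> y\<bar> \<le> norm w * norm y" by (rule Cauchy_Schwarz_ineq2)
    also have "\<dots> \<le> M" using supp[OF False] by (simp add: M_def mult_left_mono)
    finally have "\<bar>w \<bullet> y\<bar> ^ n \<le> M ^ n" by (intro power_mono) auto
    hence "norm (f y) * (\<bar>w \<bullet> y\<bar> ^ n * norm t ^ n / fact n) \<le> norm (f y) * (M ^ n * norm t ^ n / fact n)"
      by (intro mult_left_mono divide_right_mono mult_right_mono) auto
    thus ?thesis
      by (simp add: T_def h_def norm_mult norm_divide norm_power power_mult_distrib mult.assoc)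
  qed (simp add: T_def h_def)
  have F_sums: "(\<lambda>n. (LINT y|lborel. T n y) * t ^ n) sums F t" for t
  proof -
    have bound_int: "integrable lborel (\<lambda>y. norm (f y) * ((M * norm t) ^ n / fact n))" for n
      using f by (intro integrable_mult_left) auto
    have exp_summable: "summable (\<lambda>n. c * ((M * norm t) ^ n / fact n))" for c
      using summable_exp[of "M * norm t"] by (intro summable_mult) (simp add: field_simps)
    have int: "integrable lborel (\<lambda>y. T n y * t ^ n)" for n
    proof (rule Bochner_Integration.integrable_bound[OF bound_int])
      show "AE y in lborel. norm (T n y * t ^ n) \<le> norm (norm (f y) * ((M * norm t) ^ n / fact n))"
        using norm_T by (intro AE_I2) (metis abs_ge_self order_trans real_norm_def)
    qed measurable
    have "(\<lambda>n. LINT y|lborel. T n y * t ^ n) sums (LINT y|lborel. (\<Sum>n. T n y * t ^ n))"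
    proof (rule sums_integral[OF int])
      show "AE y in lborel. summable (\<lambda>n. norm (T n y * t ^ n))"
      proof (rule AE_I2)
        fix y
        show "summable (\<lambda>n. norm (T n y * t ^ n))"
          by (rule summable_comparison_test'[OF exp_summable[of "norm (f y)"], of 0])
            (simp only: real_norm_def abs_norm_cancel norm_T)
      qed
      have "(LINT y|lborel. norm (T n y * t ^ n)) \<le> (LINT y|lborel. norm (f y)) * ((M * norm t) ^ n / fact n)" for n
        using integral_mono[OF integrable_norm[OF int] bound_int norm_T] by simp
      thus "summable (\<lambda>n. LINT y|lborel. norm (T n y * t ^ n))"
        by (intro summable_comparison_test'[OF exp_summable[of "LINT y|lborel. norm (f y)"], of 0])
          (simp del: norm_mult)
    qed
    moreover have "(\<Sum>n. T n y * t ^ n) = h y * exp (t * - (\<i> * complex_of_real (w \<bullet> y)))" for y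
    proof -
      have "(\<lambda>n. h y * ((t * - (\<i> * complex_of_real (w \<bullet> y))) ^ n /\<^sub>R fact n))
          sums (h y * exp (t * - (\<i> * complex_of_real (w \<bullet> y))))"
        by (intro sums_mult exp_converges)
      moreover have "T n y * t ^ n = h y * ((t * - (\<i> * complex_of_real (w \<bullet> y))) ^ n /\<^sub>R fact n)" for n
        unfolding T_def power_mult_distrib by (simp add: scaleR_conv_of_real field_simps)
      ultimately show ?thesis by (simp add: sums_iff)
    qed
    ultimately show ?thesis by (simp add: F_def)
  qed
  have F_fourier: "F (of_real s) = fourier_transform f (k0 + s *\<^sub>R w)" for s
    by (simp add: F_def h_def fourier_transform_def inner_add_left algebra_simps exp_add exp_diff
        exp_minus field_simps)
  have F0: "F 0 = 0" using F_fourier[of 0] zero[OF U(2)] by simp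
  have "(LINT y|lborel. T n y) = 0" for n
  proof (rule ccontr)
    assume nz: "(LINT y|lborel. T n y) \<noteq> 0"
    \<comment> \<open>The theorem on isolated zeros asks for a nonzero coefficient of positive
      degree; the constant one is F 0, the transform at \<open>k0\<close>.\<close>
    have "n > 0"
    proof (rule ccontr)
      assume "\<not> n > 0"
      moreover have "(LINT y|lborel. T 0 y) = F 0"
        by (simp add: T_def F_def)
      ultimately show False using nz F0 by simp
    qed
    obtain s where s: "s > 0" "\<And>z. z \<in> cball 0 s - {0} \<Longrightarrow> F z \<noteq> 0"
      by (rule powser_0_nonzero[of 1 0 "\<lambda>n. LINT y|lborel. T n y" F n])
         (use F_sums F0 nz \<open>n > 0\<close> in auto)
    \<comment> \<open>The points k0 + r w with small r > 0 lie in \<open>U\<close>, so zeros of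
      \<open>F\<close> accumulate at 0.\<close>
    have "((\<lambda>r. k0 + r *\<^sub>R w) \<longlongrightarrow> k0 + 0 *\<^sub>R w) (at_right 0)"
      by (intro tendsto_intros)
    hence "eventually (\<lambda>r. k0 + r *\<^sub>R w \<in> U) (at_right 0)"
      using U by (intro topological_tendstoD) auto
    moreover have "eventually (\<lambda>r. r \<in> {0<..<s}) (at_right (0::real))"
      using s(1) by (rule eventually_at_right_real)
    ultimately have "eventually (\<lambda>r::real. False) (at_right 0)"
    proof eventually_elim
      case (elim r)
      hence "F (of_real r) = 0" using zero by (simp add: F_fourier)
      moreover have "F (of_real r) \<noteq> 0" using elim by (intro s(2)) auto
      ultimately show False by simp
    qed
    thus False by simp
  qed
  hence "F 1 = 0" using F_sums[of 1] by (simp add: sums_iff)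
  thus ?thesis using F_fourier[of 1] by (simp add: w_def)
qed

section \<open>Smooth functions built from exp (-1/t)\<close>

text \<open>The polynomial in 1/t makes the family closed under differentiation; p = 1 is the
  classical smooth function that is flat at 0.\<close>

definition flat_exp :: "real poly \<Rightarrow> real \<Rightarrow> real" where
  "flat_exp p t = (if t > 0 then poly p (inverse t) * exp (- inverse t) else 0)"

lemma poly_mult_exp_minus_tendsto_0:
  "((\<lambda>u::real. poly p u * exp (- u)) \<longlongrightarrow> 0) at_top"
proof -
  have "((\<lambda>u::real. \<Sum>i\<le>degree p. coeff p i * (u ^ i / exp u)) \<longlongrightarrow> (\<Sum>i\<le>degree p. coeff p i * 0)) at_top"
    by (intro tendsto_intros tendsto_power_div_exp_0)
  thus ?thesis
    by (simp add: poly_altdef sum_distrib_right exp_minus divide_inverse mult.assoc)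
qed

text \<open>With u = 1/t the chain rule multiplies by u^2 and turns p into p - p'. At 0 the
  difference quotient from the right has the extra factor 1/h, hence the polynomial
  \<open>p * [:0, 1:]\<close>, and the exponential still wins.\<close>

lemma flat_exp_has_derivative:
  "(flat_exp p has_real_derivative flat_exp ([:0, 0, 1:] * (p - pderiv p)) t) (at t)"
proof (cases "t = 0")
  case True
  have "((\<lambda>h. flat_exp p h / h) \<longlongrightarrow> 0) (at_left 0)"
    by (rule tendsto_eventually) (simp add: eventually_at_filter flat_exp_def)
  moreover have "((\<lambda>h. flat_exp p h / h) \<longlongrightarrow> 0) (at_right 0)"
  proof -
    have "((\<lambda>h::real. poly (p * [:0, 1:]) (inverse h) * exp (- inverse h)) \<longlongrightarrow> 0) (at_right 0)"
      by (rule filterlim_compose[OF poly_mult_exp_minus_tendsto_0 filterlim_inverse_at_top_right])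
    thus ?thesis
      by (rule Lim_transform_eventually) (simp add: eventually_at_filter flat_exp_def field_simps)
  qed
  ultimately have "((\<lambda>h. flat_exp p h / h) \<longlongrightarrow> 0) (at 0)"
    by (simp add: filterlim_split_at_real)
  thus ?thesis using True by (simp add: DERIV_def flat_exp_def)
next
  case False
  show ?thesis
  proof (cases "t > 0")
    case True
    have "((\<lambda>t. poly p (inverse t) * exp (- inverse t)) has_real_derivative
        flat_exp ([:0, 0, 1:] * (p - pderiv p)) t) (at t)"
      using True
      by (auto intro!: derivative_eq_intros DERIV_chain2[OF poly_DERIV] simp: flat_exp_def power2_eq_square algebra_simps)
    thus ?thesis
      by (rule has_field_derivative_transform_within_open[where S="{0<..}"]) (use True in \<open>auto simp: flat_exp_def\<close>)
  next
    case neg: False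
    have "((\<lambda>_. 0) has_real_derivative flat_exp ([:0, 0, 1:] * (p - pderiv p)) t) (at t)"
      using neg by (simp add: flat_exp_def)
    thus ?thesis
      by (rule has_field_derivative_transform_within_open[where S="{..<0}"])
        (use neg False in \<open>auto simp: flat_exp_def\<close>)
  qed
qed

text \<open>This class is closed under partial derivatives, hence consists of smooth functions.\<close>

inductive flat_algebra :: "(real ^ 'k::finite \<Rightarrow> complex) \<Rightarrow> bool" where
  flat: "flat_algebra (\<lambda>x. of_real (flat_exp p (a \<bullet> x + c)))"
| const: "flat_algebra (\<lambda>x. c)"
| add: "flat_algebra f \<Longrightarrow> flat_algebra g \<Longrightarrow> flat_algebra (\<lambda>x. f x + g x)"
| mult: "flat_algebra f \<Longrightarrow> flat_algebra g \<Longrightarrow> flat_algebra (\<lambda>x. f x * g x)"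

lemma flat_algebra_differentiable:
  "flat_algebra f \<Longrightarrow> f differentiable (at x)"
proof (induction rule: flat_algebra.induct)
  case (flat p a c)
  have "((\<lambda>x. complex_of_real (flat_exp p (a \<bullet> x + c))) has_derivative
     (\<lambda>h. complex_of_real (flat_exp ([:0, 0, 1:] * (p - pderiv p)) (a \<bullet> x + c) * (a \<bullet> h)))) (at x)"
    by (rule derivative_eq_intros flat_exp_has_derivative refl
        DERIV_compose_FDERIV[where f="flat_exp p" and g="\<lambda>x. a \<bullet> x + c"])+ (simp add: fun_eq_iff)
  thus ?case by (rule differentiableI)
qed auto

text \<open>Gives the derivative as a member of the class, so that an induction over the list of
  partial derivatives can go on from it.\<close>

lemma flat_algebra_partial:
  "flat_algebra f \<Longrightarrow> \<exists>g. flat_algebra g \<and>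
     (\<forall>x. ((\<lambda>t. f (x + t *\<^sub>R axis i 1)) has_vector_derivative g x) (at 0))"
proof (induction rule: flat_algebra.induct)
  case (flat p a c)
  let ?q = "[:0, 0, 1:] * (p - pderiv p)"
  show ?case
  proof (intro exI conjI allI)
    show "flat_algebra (\<lambda>x. of_real (a $ i) * of_real (flat_exp ?q (a \<bullet> x + c)))"
      by (intro flat_algebra.intros)
    fix x
    have "((\<lambda>t. a \<bullet> (x + t *\<^sub>R axis i 1) + c) has_real_derivative a $ i) (at 0)"
      by (auto intro!: derivative_eq_intros simp: inner_add_right inner_axis)
    from DERIV_chain2[OF flat_exp_has_derivative this]
    have "((\<lambda>t. flat_exp p (a \<bullet> (x + t *\<^sub>R axis i 1) + c)) has_real_derivative
        (a $ i * flat_exp ?q (a \<bullet> x + c))) (at 0)"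
      by (simp add: mult.commute)
    thus "((\<lambda>t. complex_of_real (flat_exp p (a \<bullet> (x + t *\<^sub>R axis i 1) + c))) has_vector_derivative
        complex_of_real (a $ i) * complex_of_real (flat_exp ?q (a \<bullet> x + c))) (at 0)"
      by (auto dest!: has_vector_derivative_of_real)
  qed
next
  case (const c)
  show ?case by (intro exI[of _ "\<lambda>_. 0"]) (auto intro: flat_algebra.const)
next
  case (add f g)
  then obtain f' g' where d: "flat_algebra f'" "flat_algebra g'"
    "\<And>x. ((\<lambda>t. f (x + t *\<^sub>R axis i 1)) has_vector_derivative f' x) (at 0)"
    "\<And>x. ((\<lambda>t. g (x + t *\<^sub>R axis i 1)) has_vector_derivative g' x) (at 0)"
    by blast
  show ?case
  proof (intro exI conjI allI)
    show "flat_algebra (\<lambda>x. f' x + g' x)"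
      by (rule flat_algebra.add[OF d(1,2)])
    show "((\<lambda>t. f (x + t *\<^sub>R axis i 1) + g (x + t *\<^sub>R axis i 1)) has_vector_derivative
        f' x + g' x) (at 0)" for x
      by (rule has_vector_derivative_add[OF d(3,4)])
  qed
next
  case (mult f g)
  then obtain f' g' where d: "flat_algebra f'" "flat_algebra g'"
    "\<And>x. ((\<lambda>t. f (x + t *\<^sub>R axis i 1)) has_vector_derivative f' x) (at 0)"
    "\<And>x. ((\<lambda>t. g (x + t *\<^sub>R axis i 1)) has_vector_derivative g' x) (at 0)"
    by blast
  show ?case
  proof (intro exI conjI allI)
    show "flat_algebra (\<lambda>x. f x * g' x + f' x * g x)"
      using d mult.hyps by (intro flat_algebra.intros)
    show "((\<lambda>t. f (x + t *\<^sub>R axis i 1) * g (x + t *\<^sub>R axis i 1)) has_vector_derivative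
        f x * g' x + f' x * g x) (at 0)" for x
      using has_vector_derivative_mult[OF d(3)[of x] d(4)[of x]] by simp
  qed
qed

lemma flat_algebra_iterated_partial:
  "flat_algebra f \<Longrightarrow> flat_algebra (iterated_partial is f)"
proof (induction "is")
  case (Cons i "is")
  then obtain g where g: "flat_algebra g"
    "\<And>x. ((\<lambda>t. iterated_partial is f (x + t *\<^sub>R axis i 1)) has_vector_derivative g x) (at 0)"
    using flat_algebra_partial by blast
  have "iterated_partial (i # is) f = g"
    using g(2) by (auto simp: fun_eq_iff partial_deriv_def intro: vector_derivative_at)
  thus ?case using g(1) by simp
qed simp

lemma flat_algebra_smooth: "flat_algebra f \<Longrightarrow> smooth f"
  unfolding smooth_def differentiable_on_def
  by (auto intro: differentiable_at_withinI flat_algebra_differentiable flat_algebra_iterated_partial)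

section \<open>Test functions, Schwartz functions and rapid decrease\<close>

text \<open>Differentiation is local: near \<open>x\<close> each coordinate line stays in the open
  set, where the preceding partial derivative already vanishes.\<close>

lemma iterated_partial_eq_0:
  assumes "open S" "\<And>x. x \<in> S \<Longrightarrow> f x = 0" "x \<in> S"
  shows "iterated_partial is f x = 0"
  using assms(3)
proof (induction "is" arbitrary: x)
  case (Cons i "is")
  have op: "open ((\<lambda>t::real. x + t *\<^sub>R axis i 1) -` S)"
    using assms(1) by (intro open_vimage continuous_intros)
  have "((\<lambda>t. iterated_partial is f (x + t *\<^sub>R axis i 1)) has_vector_derivative 0) (at 0)"
    by (rule has_vector_derivative_transform_within_open[OF has_vector_derivative_const op])
      (use Cons in auto)
  thus ?case by (simp add: partial_deriv_def vector_derivative_at)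
qed (use assms in simp)

text \<open>On the compact support each weighted derivative is continuous, hence bounded; off the
  support it vanishes by locality.\<close>

lemma test_functions_subset_schwartz: "test_functions \<subseteq> schwartz_functions"
proof
  fix f :: "real ^ 'k::finite \<Rightarrow> complex" assume "f \<in> test_functions"
  hence f: "smooth f" and K: "compact (function_support f)"
    by (auto simp: test_functions_def)
  have "bounded (range (\<lambda>x. norm x ^ m *\<^sub>R iterated_partial is f x))" for m "is"
  proof -
    let ?g = "\<lambda>x. norm x ^ m *\<^sub>R iterated_partial is f x"
    have "continuous_on (function_support f) ?g"
      using f by (intro continuous_intros continuous_on_subset[OF differentiable_imp_continuous_on])
        (auto simp: smooth_def)
    hence "bounded (?g ` function_support f)"
      using K by (intro compact_imp_bounded compact_continuous_image)
    moreover have "?g x = 0" if "x \<notin> function_support f" for x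
    proof -
      have "iterated_partial is f x = 0"
      proof (rule iterated_partial_eq_0)
        show "open (- function_support f)" by (simp add: function_support_def open_Compl)
        show "f y = 0" if "y \<in> - function_support f" for y
          using that closure_subset[of "{x. f x \<noteq> 0}"] by (auto simp: function_support_def)
      qed (use that in simp)
      thus ?thesis by simp
    qed
    hence "range ?g \<subseteq> insert 0 (?g ` function_support f)" by blast
    ultimately show ?thesis by (meson bounded_insert bounded_subset)
  qed
  thus "f \<in> schwartz_functions" using f by (simp add: schwartz_functions_def)
qed

lemma schwartz_rapidly_decreasing:
  assumes "f \<in> schwartz_functions"
  shows "rapidly_decreasing f"
proof -
  have "iterated_partial [] f differentiable_on UNIV"
    using assms by (simp only: schwartz_functions_def smooth_def mem_Collect_eq)
  moreover have "bounded (range (\<lambda>x. norm x ^ m *\<^sub>R iterated_partial [] f x))" for m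
    using assms by (simp only: schwartz_functions_def mem_Collect_eq)
  ultimately show ?thesis
    by (simp add: rapidly_decreasing_def differentiable_imp_continuous_on)
qed

section \<open>An odd bump function on the line\<close>

text \<open>A bump living on the interval from 0 to 1 minus its mirror image. Oddness makes the
  integral vanish.\<close>

definition odd_bump :: "real \<Rightarrow> real" where
  "odd_bump t = flat_exp 1 t * flat_exp 1 (1 - t) - flat_exp 1 (- t) * flat_exp 1 (1 + t)"

lemma odd_bump_eq_0: "\<bar>t\<bar> > 1 \<Longrightarrow> odd_bump t = 0"
  by (auto simp: odd_bump_def flat_exp_def)

lemma odd_bump_half: "odd_bump (1 / 2) \<noteq> 0"
  by (simp add: odd_bump_def flat_exp_def)

lemma integral_odd_bump:
  assumes "d \<noteq> 0"
  shows "(LINT t|lborel. odd_bump (c + d * t)) = 0"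
proof -
  have "(LINT t|lborel. odd_bump t) = (LINT t|lborel. odd_bump (0 + (-1) * t))"
    by (subst lborel_integral_real_affine[of "-1" _ 0]) simp_all
  also have "\<dots> = (LINT t|lborel. - odd_bump t)"
    by (rule arg_cong[where f="integral\<^sup>L lborel"]) (simp add: odd_bump_def fun_eq_iff)
  finally have "(LINT t|lborel. odd_bump t) = 0" by simp
  thus ?thesis using lborel_integral_real_affine[OF assms, of odd_bump c] assms by simp
qed

lemma flat_algebra_odd_bump: "flat_algebra (\<lambda>x. of_real (odd_bump (u \<bullet> x)))"
proof -
  \<comment> \<open>The difference is written with a product by -1 and constants inside the
    arguments, to match the closure rules of the class.\<close>
  have "flat_algebra (\<lambda>x. of_real (flat_exp 1 (u \<bullet> x + 0)) * of_real (flat_exp 1 ((- u) \<bullet> x + 1))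
      + (- 1) * (of_real (flat_exp 1 ((- u) \<bullet> x + 0)) * of_real (flat_exp 1 (u \<bullet> x + 1))))"
    by (intro flat_algebra.intros)
  thus ?thesis by (simp add: odd_bump_def add.commute)
qed

section \<open>Null directions and the vectors orthogonal to them\<close>

text \<open>The names only mark the positive and the negative coordinates: a vector lies in
  \<open>timelike_cone\<close> when its \<open>space_part\<close> is at least as long as its
  \<open>time_part\<close>.\<close>

definition space_part :: "('m::finite, 'n::finite) minkowski \<Rightarrow> real ^ 'm" where
  "space_part v = (\<chi> i. v $ Inl i)"

definition time_part :: "('m::finite, 'n::finite) minkowski \<Rightarrow> real ^ 'n" where
  "time_part v = (\<chi> j. v $ Inr j)"

lemma sum_UNIV_Plus:
  fixes g :: "'m::finite + 'n::finite \<Rightarrow> 'a::comm_monoid_add"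
  shows "(\<Sum>s\<in>UNIV. g s) = (\<Sum>i\<in>UNIV. g (Inl i)) + (\<Sum>j\<in>UNIV. g (Inr j))"
  by (simp add: sum.Plus flip: UNIV_Plus_UNIV)

lemma inner_minkowski: "k \<bullet> v = space_part k \<bullet> space_part v + time_part k \<bullet> time_part v"
  by (simp add: inner_vec_def sum_UNIV_Plus space_part_def time_part_def)

lemma norm_minkowski: "(norm v)\<^sup>2 = (norm (space_part v))\<^sup>2 + (norm (time_part v))\<^sup>2"
  by (simp add: power2_norm_eq_inner inner_minkowski)

lemma minkowski_form_eq: "minkowski_form v = (norm (space_part v))\<^sup>2 - (norm (time_part v))\<^sup>2"
  unfolding minkowski_form_def power2_norm_eq_inner
  by (simp add: inner_vec_def space_part_def time_part_def power2_eq_square)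

lemma continuous_minkowski_form: "continuous_on UNIV minkowski_form"
  unfolding minkowski_form_def by (intro continuous_intros)

lemma minkowski_form_axis_Inr: "minkowski_form (axis (Inr j) 1) < 0"
proof -
  have "axis (Inr j) (1::real) $ Inr i = (if i = j then 1 else 0)" for i :: 'b
    by (simp add: axis_def)
  thus ?thesis by (simp add: minkowski_form_def axis_def if_distrib[of "\<lambda>x. x\<^sup>2"] cong: if_cong)
qed

text \<open>From dimension two on there is a unit vector \<open>e\<close> orthogonal to
  \<open>w\<close>. Tilting the unit vector along \<open>w\<close> towards \<open>e\<close> reaches
  every inner product of absolute value at most norm w.\<close>

lemma exists_unit_vector_inner:
  fixes w :: "'a::euclidean_space"
  assumes "2 \<le> DIM('a)" "\<bar>c\<bar> \<le> norm w"
  obtains u where "norm u = 1" "w \<bullet> u = c"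
proof -
  obtain y where y: "y \<noteq> 0" "orthogonal w y"
    using orthogonal_to_vector_exists[OF assms(1)] by blast
  define e where "e = y /\<^sub>R norm y"
  have e: "e \<bullet> e = 1" "w \<bullet> e = 0"
    using y by (simp_all add: e_def orthogonal_def dot_square_norm power2_eq_square)
  show thesis
  proof (cases "w = 0")
    case True
    with assms(2) e that[of e] show thesis by (simp add: norm_eq_1)
  next
    case False
    define r where "r = c / norm w"
    have r: "r\<^sup>2 \<le> 1" using assms(2) False by (simp add: r_def power_divide abs_le_square_iff[symmetric])
    define u where "u = (r / norm w) *\<^sub>R w + sqrt (1 - r\<^sup>2) *\<^sub>R e"
    have ww: "w \<bullet> w = norm w * norm w" by (simp add: dot_square_norm power2_eq_square)
    have "u \<bullet> u = 1"
      using False e r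
      by (simp add: u_def inner_add_left inner_add_right inner_commute[of e w] ww flip: power2_eq_square)
    moreover have "w \<bullet> u = c"
      using False e by (simp add: u_def inner_add_right ww r_def)
    ultimately show thesis using that[of u] by (simp add: norm_eq_1)
  qed
qed

text \<open>The two parts of a null direction both have norm 1 / sqrt 2, so two unit vectors, one
  per factor, give one after division by sqrt 2.\<close>

lemma null_direction_of_units:
  fixes k :: "('m::finite, 'n::finite) minkowski"
  assumes a: "norm a = 1" and b: "norm b = 1" and eq: "space_part k \<bullet> a + time_part k \<bullet> b = 0"
  shows "\<exists>v\<in>null_directions. k \<bullet> v = 0"
proof -
  define v :: "('m, 'n) minkowski" where
    "v = (\<chi> s. case s of Inl i \<Rightarrow> (a /\<^sub>R sqrt 2) $ i | Inr j \<Rightarrow> (b /\<^sub>R sqrt 2) $ j)"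
  have parts: "space_part v = a /\<^sub>R sqrt 2" "time_part v = b /\<^sub>R sqrt 2"
    by (simp_all add: v_def space_part_def time_part_def vec_eq_iff)
  have "(norm v)\<^sup>2 = 1"
    by (simp add: norm_minkowski parts a b power_inverse)
  hence "v \<in> null_directions"
    by (simp add: null_directions_def minkowski_form_eq parts a b power2_eq_1_iff)
      (smt (verit) norm_ge_zero)
  moreover have "k \<bullet> v = (space_part k \<bullet> a + time_part k \<bullet> b) / sqrt 2"
    by (simp add: inner_minkowski parts field_simps)
  ultimately show ?thesis using eq by auto
qed

text \<open>With \<open>a\<close> an arbitrary unit vector, the inner product required of
  \<open>b\<close> is at most norm (space_part k) <= norm (time_part k) in absolute value. It is
  attained because the negative factor has dimension at least two.\<close>

lemma exists_null_direction_spacelike: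
  fixes k :: "('m::finite, 'n::finite) minkowski"
  assumes "CARD('n) > 1" "minkowski_form k \<le> 0"
  shows "\<exists>v\<in>null_directions. k \<bullet> v = 0"
proof -
  define a :: "real ^ 'm" where "a = axis undefined 1"
  have a: "norm a = 1" by (simp add: a_def norm_axis_1)
  have "\<bar>- (space_part k \<bullet> a)\<bar> \<le> norm (space_part k)"
    using Cauchy_Schwarz_ineq2[of "space_part k" a] a by simp
  also have "\<dots> \<le> norm (time_part k)"
    using assms(2) by (simp add: minkowski_form_eq)
  finally obtain b where "norm b = 1" "time_part k \<bullet> b = - (space_part k \<bullet> a)"
    using assms(1) by (elim exists_unit_vector_inner[rotated]) simp_all
  thus ?thesis using a by (intro null_direction_of_units) auto
qed

text \<open>The mirror case: \<open>b\<close> is arbitrary and the positive factor supplies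
  \<open>a\<close>.\<close>

lemma exists_null_direction_timelike:
  fixes k :: "('m::finite, 'n::finite) minkowski"
  assumes "CARD('m) > 1" "minkowski_form k \<ge> 0"
  shows "\<exists>v\<in>null_directions. k \<bullet> v = 0"
proof -
  define b :: "real ^ 'n" where "b = axis undefined 1"
  have b: "norm b = 1" by (simp add: b_def norm_axis_1)
  have "\<bar>- (time_part k \<bullet> b)\<bar> \<le> norm (time_part k)"
    using Cauchy_Schwarz_ineq2[of "time_part k" b] b by simp
  also have "\<dots> \<le> norm (space_part k)"
    using assms(2) by (simp add: minkowski_form_eq)
  finally obtain a where "norm a = 1" "space_part k \<bullet> a = - (time_part k \<bullet> b)"
    using assms(1) by (elim exists_unit_vector_inner[rotated]) simp_all
  thus ?thesis using b by (intro null_direction_of_units) auto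
qed

text \<open>In the one-dimensional positive factor Cauchy-Schwarz is an equality, in the negative
  factor an inequality. The two parts of \<open>v\<close> have equal nonzero norm, which
  cancels.\<close>

lemma orthogonal_to_null_direction:
  fixes k :: "('m::finite, 'n::finite) minkowski"
  assumes "CARD('m) = 1" and v: "v \<in> null_directions" and "k \<bullet> v = 0"
  shows "minkowski_form k \<le> 0"
proof -
  obtain a :: 'm where U: "UNIV = {a}"
    using assms(1) by (auto simp: card_1_singleton_iff)
  have one_dim: "\<bar>x \<bullet> y\<bar> = norm x * norm y" for x y :: "real ^ 'm"
    by (simp add: inner_vec_def norm_vec_def U abs_mult)
  have eq: "norm (time_part v) = norm (space_part v)"
    using v by (simp add: null_directions_def minkowski_form_eq power2_eq_iff_nonneg)
  have nz: "norm (space_part v) > 0"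
    using v norm_minkowski[of v] eq by (auto simp: null_directions_def)
  have "norm (space_part k) * norm (space_part v) = \<bar>time_part k \<bullet> time_part v\<bar>"
    using assms(3) one_dim[of "space_part k" "space_part v"] by (simp add: inner_minkowski)
  also have "\<dots> \<le> norm (time_part k) * norm (space_part v)"
    using Cauchy_Schwarz_ineq2[of "time_part k" "time_part v"] eq by simp
  finally have "norm (space_part k) \<le> norm (time_part k)" using nz by simp
  thus ?thesis by (simp add: minkowski_form_eq)
qed

section \<open>From the kernel to vanishing Fourier transforms\<close>

lemma null_xray_kernel_iff:
  "f \<in> null_xray_kernel \<longleftrightarrow> (\<forall>v\<in>null_directions. \<forall>x. line_integral v f x = 0)"
  by (simp add: null_xray_kernel_def null_xray_def)

lemma norm_null_direction: "v \<in> null_directions \<Longrightarrow> norm v = 1"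
  by (simp add: null_directions_def)

lemma fourier_zero_of_kernel:
  assumes "rapidly_decreasing f" "f \<in> null_xray_kernel" "v \<in> null_directions" "k \<bullet> v = 0"
  shows "fourier_transform f k = 0"
  using assms by (intro fourier_slice[of f v])
    (auto simp: null_xray_kernel_iff norm_null_direction rapidly_decreasing_integrable)

text \<open>Reduces injectivity to differences of two members of \<open>S\<close>. Rapid decrease of
  the difference suffices, so \<open>S\<close> need not be shown closed under subtraction.\<close>

lemma inj_on_null_xrayI:
  assumes S: "\<And>f. f \<in> S \<Longrightarrow> rapidly_decreasing f"
    and "\<And>f g. f \<in> S \<Longrightarrow> g \<in> S \<Longrightarrow> (\<lambda>x. f x - g x) \<in> null_xray_kernel \<Longrightarrow>
      \<forall>k. fourier_transform (\<lambda>x. f x - g x) k = 0"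
  shows "inj_on null_xray S"
proof (rule inj_onI)
  fix f g assume fg: "f \<in> S" "g \<in> S" and eq: "null_xray f = null_xray g"
  have "line_integral v (\<lambda>x. f x - g x) x = 0" if v: "v \<in> null_directions" for v x
  proof -
    have "line_integral v (\<lambda>x. f x - g x) x = line_integral v f x - line_integral v g x"
      unfolding line_integral_def using fg S v
      by (intro Bochner_Integration.integral_diff rapidly_decreasing_integrable_line norm_null_direction)
    also have "\<dots> = null_xray f v x - null_xray g v x"
      using v by (simp add: null_xray_def)
    finally show ?thesis by (simp add: eq)
  qed
  hence "(\<lambda>x. f x - g x) \<in> null_xray_kernel" by (simp add: null_xray_kernel_iff)
  hence "\<forall>k. fourier_transform (\<lambda>x. f x - g x) k = 0" by (intro assms fg)
  hence "f x - g x = 0" for x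
    using fourier_injective[OF rapidly_decreasing_diff[OF S[OF fg(1)] S[OF fg(2)]]] by blast
  thus "f = g" by (auto simp: fun_eq_iff)
qed

lemma test_functions_rapidly_decreasing: "f \<in> test_functions \<Longrightarrow> rapidly_decreasing f"
  using test_functions_subset_schwartz schwartz_rapidly_decreasing by blast

lemma test_functions_bounded_support:
  assumes "f \<in> test_functions"
  obtains R where "\<And>y. f y \<noteq> 0 \<Longrightarrow> norm y \<le> R"
proof -
  have "bounded (function_support f)"
    using assms by (auto simp: test_functions_def intro: compact_imp_bounded)
  hence "bounded {x. f x \<noteq> 0}"
    by (rule bounded_subset) (simp add: function_support_def closure_subset)
  thus ?thesis using that by (auto simp: bounded_iff)
qed

section \<open>The cases of the theorem\<close>

text \<open>p . x and q . x are the null coordinates. Along a null line one of them is constant and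
  the other runs affinely through the real line, so the product of odd bumps integrates to zero. A
  general \<open>S\<close> covers both function spaces at once.\<close>

lemma not_inj_on_null_xray_1_1:
  assumes "CARD('m::finite) = 1" "CARD('n::finite) = 1"
    and S: "test_functions \<subseteq> (S :: (('m, 'n) minkowski \<Rightarrow> complex) set)"
  shows "\<not> inj_on null_xray S"
proof -
  obtain a :: 'm where Um: "UNIV = {a}" using assms(1) by (auto simp: card_1_singleton_iff)
  obtain b :: 'n where Un: "UNIV = {b}" using assms(2) by (auto simp: card_1_singleton_iff)
  have a: "i = a" for i using Um by auto
  have b: "j = b" for j using Un by auto
  define p :: "('m, 'n) minkowski" where "p = axis (Inl a) 1 + axis (Inr b) 1"
  define q :: "('m, 'n) minkowski" where "q = axis (Inl a) 1 - axis (Inr b) 1"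
  have pq: "p \<bullet> x = x $ Inl a + x $ Inr b" "q \<bullet> x = x $ Inl a - x $ Inr b" for x
    by (simp_all add: p_def q_def inner_add_left inner_diff_left inner_axis')
  define f :: "('m, 'n) minkowski \<Rightarrow> complex" where
    "f x = of_real (odd_bump (p \<bullet> x)) * of_real (odd_bump (q \<bullet> x))" for x
  have "smooth f"
    unfolding f_def by (intro flat_algebra_smooth flat_algebra.mult flat_algebra_odd_bump)
  moreover have "compact (function_support f)"
  proof -
    have "norm x \<le> 2" if "f x \<noteq> 0" for x
    proof -
      have "\<bar>p \<bullet> x\<bar> \<le> 1" "\<bar>q \<bullet> x\<bar> \<le> 1"
        using that odd_bump_eq_0[of "p \<bullet> x"] odd_bump_eq_0[of "q \<bullet> x"] by (force simp: f_def)+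
      hence "\<bar>x $ Inl a\<bar> + \<bar>x $ Inr b\<bar> \<le> 2" unfolding pq by linarith
      moreover have "norm x \<le> \<bar>x $ Inl a\<bar> + \<bar>x $ Inr b\<bar>"
        using norm_le_l1_cart[of x] by (simp add: sum_UNIV_Plus Um Un)
      ultimately show ?thesis by linarith
    qed
    hence "bounded {x. f x \<noteq> 0}" by (auto simp: bounded_iff)
    thus ?thesis by (simp add: function_support_def)
  qed
  ultimately have f: "f \<in> test_functions" by (simp add: test_functions_def)
  have "flat_algebra (\<lambda>x :: ('m, 'n) minkowski. 0)" by (rule flat_algebra.const)
  hence zero: "(\<lambda>x. 0) \<in> (test_functions :: (('m, 'n) minkowski \<Rightarrow> complex) set)"
    by (simp add: test_functions_def function_support_def flat_algebra_smooth)
  have line_f: "line_integral v f x = 0" if v: "v \<in> null_directions" for v x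
  proof -
    have sq: "(v $ Inl a)\<^sup>2 = (v $ Inr b)\<^sup>2" "norm v = 1"
      using v by (simp_all add: null_directions_def minkowski_form_def Um Un)
    have nz: "v $ Inl a \<noteq> 0"
    proof
      assume "v $ Inl a = 0"
      hence "v $ s = 0" for s using sq a b by (cases s) (metis zero_eq_power2)+
      hence "v = 0" by (simp add: vec_eq_iff)
      thus False using sq by simp
    qed
    have bump: "(LINT t|lborel. c * complex_of_real (odd_bump (s + t * d))) = 0" if "d \<noteq> 0" for c s d
      using integral_odd_bump[OF that, of s] by (simp add: mult.commute)
    from sq consider "v $ Inl a = v $ Inr b" | "v $ Inl a = - v $ Inr b"
      by (auto simp: power2_eq_iff)
    thus ?thesis
    proof cases
      case 1
      hence "q \<bullet> v = 0" "p \<bullet> v \<noteq> 0" using nz by (simp_all add: pq)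
      thus ?thesis using bump[of "p \<bullet> v" "of_real (odd_bump (q \<bullet> x))" "p \<bullet> x"]
        by (simp add: line_integral_def f_def inner_add_right mult.commute)
    next
      case 2
      hence "p \<bullet> v = 0" "q \<bullet> v \<noteq> 0" using nz by (simp_all add: pq)
      thus ?thesis using bump[of "q \<bullet> v" "of_real (odd_bump (p \<bullet> x))" "q \<bullet> x"]
        by (simp add: line_integral_def f_def inner_add_right)
    qed
  qed
  have "null_xray f = null_xray (\<lambda>x. 0)"
    by (auto simp: null_xray_def restrict_def line_f fun_eq_iff) (simp add: line_integral_def)
  \<comment> \<open>Both null coordinates of this point are 1/2, where the bump is nonzero.\<close>
  moreover have "f (axis (Inl a) (1 / 2)) \<noteq> 0"
    by (simp add: f_def pq axis_def odd_bump_half)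
  hence "f \<noteq> (\<lambda>x. 0)" by metis
  ultimately show ?thesis
    using f zero S unfolding inj_on_def by blast
qed

text \<open>The transform of the difference vanishes on the nonempty open set where
  \<open>minkowski_form\<close> is negative, and bounded support propagates this to all
  frequencies.\<close>

lemma inj_on_null_xray_test_functions:
  assumes "CARD('n::finite) > 1"
  shows "inj_on null_xray (test_functions :: (('m::finite, 'n) minkowski \<Rightarrow> complex) set)"
proof (rule inj_on_null_xrayI)
  fix f g :: "('m, 'n) minkowski \<Rightarrow> complex"
  assume f: "f \<in> test_functions" and g: "g \<in> test_functions"
    and ker: "(\<lambda>x. f x - g x) \<in> null_xray_kernel"
  obtain R R' where R: "\<And>y. f y \<noteq> 0 \<Longrightarrow> norm y \<le> R" "\<And>y. g y \<noteq> 0 \<Longrightarrow> norm y \<le> R'"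
    using test_functions_bounded_support[OF f] test_functions_bounded_support[OF g] by metis
  have rd: "rapidly_decreasing (\<lambda>x. f x - g x)"
    using f g by (intro rapidly_decreasing_diff test_functions_rapidly_decreasing)
  show "\<forall>k. fourier_transform (\<lambda>x. f x - g x) k = 0"
  proof
    fix k
    show "fourier_transform (\<lambda>x. f x - g x) k = 0"
    proof (rule fourier_unique_continuation)
      show "integrable lborel (\<lambda>x. f x - g x)" by (rule rapidly_decreasing_integrable[OF rd])
      show "norm y \<le> max R R'" if "f y - g y \<noteq> 0" for y
        using that R[of y] by (cases "f y = 0") auto
      show "open {k :: ('m, 'n) minkowski. minkowski_form k < 0}"
        using continuous_minkowski_form by (intro open_Collect_less) auto
      show "axis (Inr undefined) 1 \<in> {k :: ('m, 'n) minkowski. minkowski_form k < 0}"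
        by (simp add: minkowski_form_axis_Inr)
      fix k :: "('m, 'n) minkowski" assume "k \<in> {k. minkowski_form k < 0}"
      then obtain v where "v \<in> null_directions" "k \<bullet> v = 0"
        using exists_null_direction_spacelike[OF assms, of k] by auto
      thus "fourier_transform (\<lambda>x. f x - g x) k = 0"
        by (rule fourier_zero_of_kernel[OF rd ker])
    qed
  qed
qed (rule test_functions_rapidly_decreasing)

text \<open>Whatever the sign of \<open>minkowski_form k\<close>, one of the two factors supplies a
  null direction orthogonal to \<open>k\<close>; no continuation is involved.\<close>

lemma inj_on_null_xray_schwartz_functions:
  assumes "CARD('m::finite) > 1" "CARD('n::finite) > 1"
  shows "inj_on null_xray (schwartz_functions :: (('m, 'n) minkowski \<Rightarrow> complex) set)"
proof (rule inj_on_null_xrayI, rule schwartz_rapidly_decreasing)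
  fix f g :: "('m, 'n) minkowski \<Rightarrow> complex"
  assume f: "f \<in> schwartz_functions" and g: "g \<in> schwartz_functions"
    and ker: "(\<lambda>x. f x - g x) \<in> null_xray_kernel"
  have rd: "rapidly_decreasing (\<lambda>x. f x - g x)"
    using f g by (intro rapidly_decreasing_diff schwartz_rapidly_decreasing)
  show "\<forall>k. fourier_transform (\<lambda>x. f x - g x) k = 0"
  proof
    fix k :: "('m, 'n) minkowski"
    obtain v where "v \<in> null_directions" "k \<bullet> v = 0"
      using exists_null_direction_spacelike[OF assms(2), of k]
        exists_null_direction_timelike[OF assms(1), of k] linear by blast
    thus "fourier_transform (\<lambda>x. f x - g x) k = 0"
      by (rule fourier_zero_of_kernel[OF rd ker])
  qed
qed

text \<open>Moving \<open>k\<close> outwards along one negative coordinate axis strictly decreases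
  the form.\<close>

lemma spacelike_approximation:
  fixes k :: "('m::finite, 'n::finite) minkowski"
  assumes "minkowski_form k \<le> 0"
  shows "\<exists>X. X \<longlonglongrightarrow> k \<and> (\<forall>n::nat. minkowski_form (X n) < 0)"
proof -
  define j :: 'n where "j = undefined"
  \<comment> \<open>The sign for which the absolute value of the coordinate grows, also when the
    coordinate is 0.\<close>
  define s where "s = (if k $ Inr j \<ge> 0 then 1 else - 1 :: real)"
  define X where "X n = k + (s * inverse (real (Suc n))) *\<^sub>R axis (Inr j) 1" for n
  have "X \<longlonglongrightarrow> k + (s * 0) *\<^sub>R axis (Inr j) 1"
    unfolding X_def by (intro tendsto_add tendsto_const tendsto_scaleR tendsto_mult LIMSEQ_inverse_real_of_nat)
  hence "X \<longlonglongrightarrow> k" by simp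
  moreover have "minkowski_form (X n) < 0" for n
  proof -
    define e where "e = inverse (real (Suc n))"
    have e: "e > 0" by (simp add: e_def)
    have space: "X n $ Inl i = k $ Inl i" for i by (simp add: X_def axis_def)
    have time: "X n $ Inr i = k $ Inr i + (if i = j then s * e else 0)" for i
      by (simp add: X_def axis_def e_def)
    have "(\<Sum>i\<in>UNIV. (k $ Inr i)\<^sup>2) < (\<Sum>i\<in>UNIV. (X n $ Inr i)\<^sup>2)"
    proof (rule sum_strict_mono_ex1)
      have "(k $ Inr j)\<^sup>2 < (k $ Inr j + s * e)\<^sup>2"
      proof -
        have "k $ Inr j * s \<ge> 0" by (simp add: s_def)
        hence "k $ Inr j * s * e \<ge> 0" using e by simp
        moreover have "(k $ Inr j + s * e)\<^sup>2 = (k $ Inr j)\<^sup>2 + 2 * (k $ Inr j * s * e) + e\<^sup>2"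
          by (simp add: s_def power2_eq_square algebra_simps)
        moreover have "e\<^sup>2 > 0" using e by simp
        ultimately show ?thesis by linarith
      qed
      hence strict: "(k $ Inr j)\<^sup>2 < (X n $ Inr j)\<^sup>2" by (simp add: time)
      thus "\<exists>i\<in>UNIV. (k $ Inr i)\<^sup>2 < (X n $ Inr i)\<^sup>2" by blast
      show "\<forall>i\<in>UNIV. (k $ Inr i)\<^sup>2 \<le> (X n $ Inr i)\<^sup>2"
        using strict by (auto simp: time)
    qed simp
    thus ?thesis using assms by (simp add: minkowski_form_def space)
  qed
  ultimately show ?thesis by blast
qed

text \<open>The support condition says that the transform vanishes where the form is negative. Those
  frequencies are orthogonal to some null direction; conversely, every frequency orthogonal to a
  null direction has nonpositive form.\<close>

lemma null_xray_kernel_schwartz_iff: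
  fixes f :: "('m::finite, 'n::finite) minkowski \<Rightarrow> complex"
  assumes m: "CARD('m) = 1" and n: "CARD('n) > 1" and f: "f \<in> schwartz_functions"
  shows "f \<in> null_xray_kernel \<longleftrightarrow> function_support (fourier_transform f) \<subseteq> timelike_cone"
proof -
  have rd: "rapidly_decreasing f" by (rule schwartz_rapidly_decreasing[OF f])
  have closed: "closed (timelike_cone :: ('m, 'n) minkowski set)"
    unfolding timelike_cone_def using continuous_minkowski_form by (intro closed_Collect_le) auto
  have supp: "function_support (fourier_transform f) \<subseteq> timelike_cone \<longleftrightarrow>
      (\<forall>k. minkowski_form k < 0 \<longrightarrow> fourier_transform f k = 0)"
  proof -
    have closure_iff: "closure A \<subseteq> timelike_cone \<longleftrightarrow> A \<subseteq> timelike_cone" for A :: "('m, 'n) minkowski set"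
      using closure_minimal[OF _ closed] closure_subset by blast
    show ?thesis
      unfolding function_support_def closure_iff unfolding timelike_cone_def subset_iff mem_Collect_eq
      by (metis not_le)
  qed
  show ?thesis
    unfolding supp
  proof (intro iffI allI impI)
    fix k :: "('m, 'n) minkowski" assume ker: "f \<in> null_xray_kernel" and k: "minkowski_form k < 0"
    then obtain v where "v \<in> null_directions" "k \<bullet> v = 0"
      using exists_null_direction_spacelike[OF n, of k] by auto
    thus "fourier_transform f k = 0" by (rule fourier_zero_of_kernel[OF rd ker])
  next
    assume zero: "\<forall>k. minkowski_form k < 0 \<longrightarrow> fourier_transform f k = 0"
    \<comment> \<open>The hyperplanes orthogonal to null directions also meet the light cone itself,
      where the form is 0; there the vanishing follows by continuity.\<close>
    have zero': "fourier_transform f k = 0" if k: "minkowski_form k \<le> 0" for k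
    proof -
      obtain X where X: "X \<longlonglongrightarrow> k" "\<And>n. minkowski_form (X n) < 0"
        using spacelike_approximation[OF k] by blast
      have "isCont (fourier_transform f) k"
        using continuous_fourier_transform[OF rapidly_decreasing_integrable[OF rd]]
        by (simp add: continuous_on_eq_continuous_at)
      hence "(\<lambda>n. fourier_transform f (X n)) \<longlonglongrightarrow> fourier_transform f k"
        using X(1) by (rule isCont_tendsto_compose)
      thus ?thesis using zero X(2) by (simp add: LIMSEQ_const_iff)
    qed
    show "f \<in> null_xray_kernel"
      unfolding null_xray_kernel_iff
      using orthogonal_to_null_direction[OF m]
      by (auto intro!: fourier_slice_converse[OF rd] zero' simp: norm_null_direction)
  qed
qed

theorem corollary7:
  shows
    "(CARD('m::finite) = 1 \<and> CARD('n::finite) = 1 \<longrightarrow>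
        \<not> inj_on null_xray (schwartz_functions :: (('m, 'n) minkowski \<Rightarrow> complex) set) \<and>
        \<not> inj_on null_xray (test_functions :: (('m, 'n) minkowski \<Rightarrow> complex) set)) \<and>
     (CARD('m) = 1 \<and> CARD('n) > 1 \<longrightarrow>
        inj_on null_xray (test_functions :: (('m, 'n) minkowski \<Rightarrow> complex) set)) \<and>
     (CARD('m) = 1 \<and> CARD('n) > 1 \<longrightarrow>
        {f \<in> schwartz_functions. f \<in> null_xray_kernel} =
        {f :: ('m, 'n) minkowski \<Rightarrow> complex. f \<in> schwartz_functions \<and>
           function_support (fourier_transform f) \<subseteq> timelike_cone}) \<and>
     (CARD('m) > 1 \<and> CARD('n) > 1 \<longrightarrow>
        inj_on null_xray (schwartz_functions :: (('m, 'n) minkowski \<Rightarrow> complex) set) \<and>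
        inj_on null_xray (test_functions :: (('m, 'n) minkowski \<Rightarrow> complex) set))"
proof (intro conjI impI; (elim conjE)?)
  assume card: "CARD('m) = 1" "CARD('n) = 1"
  show "\<not> inj_on null_xray (schwartz_functions :: (('m, 'n) minkowski \<Rightarrow> complex) set)"
    by (rule not_inj_on_null_xray_1_1[OF card test_functions_subset_schwartz])
  show "\<not> inj_on null_xray (test_functions :: (('m, 'n) minkowski \<Rightarrow> complex) set)"
    by (rule not_inj_on_null_xray_1_1[OF card subset_refl])
next
  assume "CARD('m) = 1" "CARD('n) > 1"
  thus "{f \<in> schwartz_functions. f \<in> null_xray_kernel} =
        {f :: ('m, 'n) minkowski \<Rightarrow> complex. f \<in> schwartz_functions \<and>
           function_support (fourier_transform f) \<subseteq> timelike_cone}"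
    using null_xray_kernel_schwartz_iff by blast
\<comment> \<open>For test functions a single lemma serves both remaining claims, as its only
  dimension hypothesis is \<open>CARD('n) > 1\<close>.\<close>
qed (simp_all add: inj_on_null_xray_test_functions inj_on_null_xray_schwartz_functions)

end
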